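(* Let $p\in\mathbb{C}[z]$ be a polynomial of degree $\nu\ge 2$ with only simple zeroes, and let $Y_p=\{(x,y,z)\in\mathbb{C}^3 : xy=p(z)\}$ be the corresponding Danielewski surface. Let $$D_1=p'(z)\frac{\partial}{\partial x}+y\frac{\partial}{\partial z},\quad D_2=p'(z)\frac{\partial}{\partial y}+x\frac{\partial}{\partial z},\quad D_3=yD_1,\quad D_4=xD_2,$$ which are locally nilpotent derivations on $\mathbb{C}[Y_p]$. Then the group generated by the flows of $D_1,D_2,D_3,D_4$ acts generically infinitely transitively on $Y_p$.
   Context: For an affine variety $X$ over $\mathbb{C}$, the flow of a locally nilpotent derivation $D$ of $\mathbb{C}[X]$ is the one-parameter subgroup $\{\exp(tD): t\in\mathbb{C}\}$ of $\operatorname{Aut}(X)$. An action of a group $G$ on an algebraic variety $X$ is called generically infinitely transitive if for every positive integer $m$ the diagonal action of $G$ on $X^m=X\times\cdots\times X$ ($m$ times) has a (non-empty) Zariski open orbit. *)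

theory Defs
  imports
    "HOL-Analysis.Analysis"
    "HOL-Computational_Algebra.Polynomial"
    "HOL-Algebra.Generated_Groups"
    "HOL-Algebra.Group_Action"
begin

section \<open>Regular functions on affine varieties\<close>

text \<open>
  Over the infinite field of complex numbers, polynomials are identified with polynomial functions:
  the algebra generated by a set \<open>B\<close> of coordinate functions.
\<close>

inductive_set poly_funs :: "('a \<Rightarrow> complex) set \<Rightarrow> ('a \<Rightarrow> complex) set"
  for B :: "('a \<Rightarrow> complex) set" where
  coord: "b \<in> B \<Longrightarrow> b \<in> poly_funs B"
| const: "(\<lambda>_. c) \<in> poly_funs B"
| add: "f \<in> poly_funs B \<Longrightarrow> g \<in> poly_funs B \<Longrightarrow> (\<lambda>q. f q + g q) \<in> poly_funs B"
| mult: "f \<in> poly_funs B \<Longrightarrow> g \<in> poly_funs B \<Longrightarrow> (\<lambda>q. f q * g q) \<in> poly_funs B"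

definition affine_coords :: "(complex ^ 'n \<Rightarrow> complex) set" where
  "affine_coords = {\<lambda>q. q $ i | i. True}"

text \<open>
  An affine variety is a Zariski closed set of points \<open>X\<close>; the elements of its coordinate ring are
  extensional functions on \<open>X\<close>, so that functions agreeing on \<open>X\<close> are equal.
\<close>

definition coord_ring :: "(complex ^ 'n) set \<Rightarrow> (complex ^ 'n \<Rightarrow> complex) set" where
  "coord_ring X = (\<lambda>F. restrict F X) ` poly_funs affine_coords"

text \<open>The points of \<open>X\<^sup>m\<close> are the extensional families indexed by \<open>{..<m}\<close>.\<close>

definition cart_power :: "(complex ^ 'n) set \<Rightarrow> nat \<Rightarrow> (nat \<Rightarrow> complex ^ 'n) set" where
  "cart_power X m = (\<Pi>\<^sub>E k\<in>{..<m}. X)"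

definition power_coords :: "nat \<Rightarrow> ((nat \<Rightarrow> complex ^ 'n) \<Rightarrow> complex) set" where
  "power_coords m = {\<lambda>w. w k $ i | k i. k < m}"

definition zariski_closed_in_power ::
    "(complex ^ 'n) set \<Rightarrow> nat \<Rightarrow> (nat \<Rightarrow> complex ^ 'n) set \<Rightarrow> bool" where
  "zariski_closed_in_power X m Z \<longleftrightarrow>
     (\<exists>S \<subseteq> poly_funs (power_coords m). Z = {w \<in> cart_power X m. \<forall>f\<in>S. f w = 0})"

definition zariski_open_in_power ::
    "(complex ^ 'n) set \<Rightarrow> nat \<Rightarrow> (nat \<Rightarrow> complex ^ 'n) set \<Rightarrow> bool" where
  "zariski_open_in_power X m U \<longleftrightarrow>
     U \<subseteq> cart_power X m \<and> zariski_closed_in_power X m (cart_power X m - U)"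


section \<open>Automorphisms\<close>

definition regular_map :: "(complex ^ 'n) set \<Rightarrow> (complex ^ 'n \<Rightarrow> complex ^ 'n) \<Rightarrow> bool" where
  "regular_map X \<phi> \<longleftrightarrow> \<phi> ` X \<subseteq> X \<and> (\<forall>i. (\<lambda>q\<in>X. \<phi> q $ i) \<in> coord_ring X)"

definition aut_group :: "(complex ^ 'n) set \<Rightarrow> (complex ^ 'n \<Rightarrow> complex ^ 'n) monoid" where
  "aut_group X = (BijGroup X)
     \<lparr>carrier := {\<phi> \<in> Bij X. regular_map X \<phi> \<and> regular_map X (restrict (inv_into X \<phi>) X)}\<rparr>"


section \<open>Locally nilpotent derivations and their flows\<close>

definition derivation ::
    "(complex ^ 'n) set \<Rightarrow> ((complex ^ 'n \<Rightarrow> complex) \<Rightarrow> (complex ^ 'n \<Rightarrow> complex)) \<Rightarrow> bool" where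
  "derivation X D \<longleftrightarrow>
     (\<forall>f \<in> coord_ring X. D f \<in> coord_ring X) \<and>
     (\<forall>f \<in> coord_ring X. \<forall>g \<in> coord_ring X.
        D (\<lambda>q\<in>X. f q + g q) = (\<lambda>q\<in>X. D f q + D g q)) \<and>
     (\<forall>c. \<forall>f \<in> coord_ring X. D (\<lambda>q\<in>X. c * f q) = (\<lambda>q\<in>X. c * D f q)) \<and>
     (\<forall>f \<in> coord_ring X. \<forall>g \<in> coord_ring X.
        D (\<lambda>q\<in>X. f q * g q) = (\<lambda>q\<in>X. D f q * g q + f q * D g q))"

definition locally_nilpotent_derivation ::
    "(complex ^ 'n) set \<Rightarrow> ((complex ^ 'n \<Rightarrow> complex) \<Rightarrow> (complex ^ 'n \<Rightarrow> complex)) \<Rightarrow> bool" where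
  "locally_nilpotent_derivation X D \<longleftrightarrow>
     derivation X D \<and> (\<forall>f \<in> coord_ring X. \<exists>k. (D ^^ k) f = (\<lambda>q\<in>X. 0))"

text \<open>For locally nilpotent \<open>D\<close> and regular \<open>f\<close>, only finitely many terms of this series are nonzero.\<close>

definition exp_derivation ::
    "(complex ^ 'n) set \<Rightarrow> ((complex ^ 'n \<Rightarrow> complex) \<Rightarrow> (complex ^ 'n \<Rightarrow> complex)) \<Rightarrow> complex
       \<Rightarrow> (complex ^ 'n \<Rightarrow> complex) \<Rightarrow> (complex ^ 'n \<Rightarrow> complex)" where
  "exp_derivation X D t f = (\<lambda>q\<in>X. \<Sum>k. t ^ k / fact k * (D ^^ k) f q)"

text \<open>
  The algebra automorphism \<open>exp(tD)\<close> of the coordinate ring is identified with the automorphism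
  \<open>\<phi>\<close> of \<open>X\<close> of which it is the comorphism \<open>f \<mapsto> f \<circ> \<phi>\<close>. The other convention, using the inverse
  of \<open>\<phi>\<close>, replaces \<open>t\<close> by \<open>-t\<close> and gives the same subgroup.
\<close>

definition flow ::
    "(complex ^ 'n) set \<Rightarrow> ((complex ^ 'n \<Rightarrow> complex) \<Rightarrow> (complex ^ 'n \<Rightarrow> complex))
       \<Rightarrow> (complex ^ 'n \<Rightarrow> complex ^ 'n) set" where
  "flow X D = {\<phi> \<in> carrier (aut_group X).
     \<exists>t. \<forall>f \<in> coord_ring X. (\<lambda>q\<in>X. f (\<phi> q)) = exp_derivation X D t f}"

definition flow_group ::
    "(complex ^ 'n) set \<Rightarrow> ((complex ^ 'n \<Rightarrow> complex) \<Rightarrow> (complex ^ 'n \<Rightarrow> complex)) set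
       \<Rightarrow> (complex ^ 'n \<Rightarrow> complex ^ 'n) monoid" where
  "flow_group X \<D> = subgroup_generated (aut_group X) (\<Union>D\<in>\<D>. flow X D)"


section \<open>Generically infinitely transitive actions\<close>

definition diagonal_action ::
    "(complex ^ 'n) set \<Rightarrow> nat \<Rightarrow> ('g \<Rightarrow> complex ^ 'n \<Rightarrow> complex ^ 'n)
       \<Rightarrow> 'g \<Rightarrow> (nat \<Rightarrow> complex ^ 'n) \<Rightarrow> (nat \<Rightarrow> complex ^ 'n)" where
  "diagonal_action X m act g = (\<lambda>w \<in> cart_power X m. \<lambda>k\<in>{..<m}. act g (w k))"

definition generically_infinitely_transitive ::
    "('g, 'b) monoid_scheme \<Rightarrow> (complex ^ 'n) set \<Rightarrow> ('g \<Rightarrow> complex ^ 'n \<Rightarrow> complex ^ 'n) \<Rightarrow> bool"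
  where
  "generically_infinitely_transitive G X act \<longleftrightarrow>
     group_action G X act \<and>
     (\<forall>m>0. \<exists>w \<in> cart_power X m.
        zariski_open_in_power X m (orbit G (diagonal_action X m act) w))"


section \<open>Danielewski surfaces and the four derivations\<close>

text \<open>The coordinates \<open>(x, y, z)\<close> are \<open>(q $ 1, q $ 2, q $ 3)\<close>.\<close>

definition danielewski :: "complex poly \<Rightarrow> (complex ^ 3) set" where
  "danielewski p = {q. q $ 1 * q $ 2 = poly p (q $ 3)}"

definition partial_deriv :: "'n \<Rightarrow> (complex ^ 'n \<Rightarrow> complex) \<Rightarrow> complex ^ 'n \<Rightarrow> complex" where
  "partial_deriv i F q = deriv (\<lambda>s. F (\<chi> j. if j = i then s else q $ j)) (q $ i)"

text \<open>
  The map that an operator \<open>V\<close> on the polynomials of the ambient space induces on the coordinate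
  ring of \<open>X\<close>. As in the quotient by the ideal of \<open>X\<close>, the value must not depend on the polynomial
  representing a regular function; otherwise the element selected below is unspecified.
\<close>

definition induced ::
    "(complex ^ 'n) set \<Rightarrow> ((complex ^ 'n \<Rightarrow> complex) \<Rightarrow> (complex ^ 'n \<Rightarrow> complex))
       \<Rightarrow> (complex ^ 'n \<Rightarrow> complex) \<Rightarrow> (complex ^ 'n \<Rightarrow> complex)" where
  "induced X V f =
     the_elem ((\<lambda>F. restrict (V F) X) ` {F \<in> poly_funs affine_coords. restrict F X = f})"

definition field1 :: "complex poly \<Rightarrow> (complex ^ 3 \<Rightarrow> complex) \<Rightarrow> (complex ^ 3 \<Rightarrow> complex)" where
  "field1 p F = (\<lambda>q. poly (pderiv p) (q $ 3) * partial_deriv 1 F q + q $ 2 * partial_deriv 3 F q)"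

definition field2 :: "complex poly \<Rightarrow> (complex ^ 3 \<Rightarrow> complex) \<Rightarrow> (complex ^ 3 \<Rightarrow> complex)" where
  "field2 p F = (\<lambda>q. poly (pderiv p) (q $ 3) * partial_deriv 2 F q + q $ 1 * partial_deriv 3 F q)"

definition D1 :: "complex poly \<Rightarrow> (complex ^ 3 \<Rightarrow> complex) \<Rightarrow> (complex ^ 3 \<Rightarrow> complex)" where
  "D1 p = induced (danielewski p) (field1 p)"

definition D2 :: "complex poly \<Rightarrow> (complex ^ 3 \<Rightarrow> complex) \<Rightarrow> (complex ^ 3 \<Rightarrow> complex)" where
  "D2 p = induced (danielewski p) (field2 p)"

definition D3 :: "complex poly \<Rightarrow> (complex ^ 3 \<Rightarrow> complex) \<Rightarrow> (complex ^ 3 \<Rightarrow> complex)" where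
  "D3 p f = (\<lambda>q \<in> danielewski p. q $ 2 * D1 p f q)"

definition D4 :: "complex poly \<Rightarrow> (complex ^ 3 \<Rightarrow> complex) \<Rightarrow> (complex ^ 3 \<Rightarrow> complex)" where
  "D4 p f = (\<lambda>q \<in> danielewski p. q $ 1 * D2 p f q)"


section \<open>The induced derivations are well defined\<close>

lemma poly_fun_partial:
  fixes q :: "complex ^ 'n"
  assumes "F \<in> poly_funs affine_coords"
  shows "((\<lambda>s. F (\<chi> j. if j = i then s else q $ j)) has_field_derivative partial_deriv i F q)
           (at (q $ i))"
proof -
  have "(\<lambda>s. F (\<chi> j. if j = i then s else q $ j)) field_differentiable at (q $ i)"
    using assms
  proof induction
    case (coord b)
    then obtain k where b: "b = (\<lambda>q. q $ k)" by (auto simp: affine_coords_def)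
    show ?case by (cases "k = i") (simp_all add: b)
  qed (auto intro!: field_differentiable_add field_differentiable_mult)
  then show ?thesis
    unfolding partial_deriv_def by (simp add: field_differentiable_derivI)
qed

lemma poly_fun_chain:
  fixes c :: "complex \<Rightarrow> complex ^ 'n"
  assumes "F \<in> poly_funs affine_coords"
    and c: "\<And>i. ((\<lambda>t. c t $ i) has_field_derivative v i) (at 0)"
  shows "((\<lambda>t. F (c t)) has_field_derivative (\<Sum>i\<in>UNIV. v i * partial_deriv i F (c 0))) (at 0)"
  using assms(1)
proof induction
  case (coord b)
  then obtain k where b: "b = (\<lambda>q. q $ k)" by (auto simp: affine_coords_def)
  have "partial_deriv i b (c 0) = (if i = k then 1 else 0)" for i
    by (cases "i = k") (simp_all add: partial_deriv_def b)
  then have "(\<Sum>i\<in>UNIV. v i * partial_deriv i b (c 0)) = v k"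
    by (simp add: if_distrib[of "\<lambda>x. _ * x"] sum.delta cong: if_cong)
  then show ?case using c[of k] by (simp add: b)
next
  case (const a)
  then show ?case by (simp add: partial_deriv_def)
next
  case (add f g)
  have "partial_deriv i (\<lambda>q. f q + g q) (c 0)
          = partial_deriv i f (c 0) + partial_deriv i g (c 0)" for i
    unfolding partial_deriv_def[of i "\<lambda>q. f q + g q"]
    by (rule DERIV_imp_deriv)
       (intro DERIV_add poly_fun_partial add.hyps)
  then show ?case
    using DERIV_add[OF add.IH] by (simp add: distrib_left sum.distrib)
next
  case (mult f g)
  have upd: "(\<chi> j. if j = i then c 0 $ i else c 0 $ j) = c 0" for i
    by (simp add: vec_eq_iff)
  have "partial_deriv i (\<lambda>q. f q * g q) (c 0)
          = partial_deriv i f (c 0) * g (c 0) + partial_deriv i g (c 0) * f (c 0)" for i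
    unfolding partial_deriv_def[of i "\<lambda>q. f q * g q"]
    using DERIV_mult[OF poly_fun_partial[OF mult.hyps(1), of i "c 0"]
        poly_fun_partial[OF mult.hyps(2), of i "c 0"]]
    by (intro DERIV_imp_deriv) (simp only: upd)
  then show ?case
    using DERIV_mult[OF mult.IH]
    by (simp add: sum_distrib_right sum.distrib distrib_left mult.assoc)
qed

text \<open>Through every point there is a curve in the variety with the velocity prescribed by the field.\<close>

lemma induced_restrict:
  fixes X :: "(complex ^ 'n) set"
  assumes V: "\<And>F q. F \<in> poly_funs affine_coords \<Longrightarrow> q \<in> X \<Longrightarrow>
                V F q = (\<Sum>i\<in>UNIV. v q i * partial_deriv i F q)"
    and curve: "\<And>q. q \<in> X \<Longrightarrow> \<exists>c. c 0 = q \<and> (\<forall>t. c t \<in> X) \<and>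
                (\<forall>i. ((\<lambda>t. c t $ i) has_field_derivative v q i) (at 0))"
    and F: "F \<in> poly_funs affine_coords"
  shows "induced X V (restrict F X) = restrict (V F) X"
proof -
  have "restrict (V G) X = restrict (V F) X"
    if G: "G \<in> poly_funs affine_coords" and eq: "restrict G X = restrict F X" for G
  proof (rule restrict_ext)
    fix q assume q: "q \<in> X"
    obtain c where c: "c 0 = q" "\<And>t. c t \<in> X"
        "\<And>i. ((\<lambda>t. c t $ i) has_field_derivative v q i) (at 0)"
      using curve[OF q] by blast
    have "G (c t) = F (c t)" for t
      using fun_cong[OF eq, of "c t"] c(2) by simp
    then have "((\<lambda>t. F (c t)) has_field_derivative V G q) (at 0)"
      using poly_fun_chain[OF G c(3)] by (simp add: V[OF G q] c(1))
    moreover have "((\<lambda>t. F (c t)) has_field_derivative V F q) (at 0)"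
      using poly_fun_chain[OF F c(3)] by (simp add: V[OF F q] c(1))
    ultimately show "V G q = V F q"
      by (rule DERIV_unique)
  qed
  then have "(\<lambda>G. restrict (V G) X) ` {G \<in> poly_funs affine_coords. restrict G X = restrict F X}
               = {restrict (V F) X}"
    using F by blast
  then show ?thesis by (simp add: induced_def)
qed

lemma danielewski_curve:
  fixes p :: "complex poly" and a b z :: complex
  assumes "a * b = poly p z"
  shows "\<exists>g. g 0 = a \<and> (\<forall>t. g t * b = poly p (z + t * b)) \<and>
           (g has_field_derivative poly (pderiv p) z) (at 0)"
proof (cases "b = 0")
  case True
  show ?thesis
    by (rule exI[of _ "\<lambda>t. a + t * poly (pderiv p) z"])
       (use assms True in \<open>auto intro!: derivative_eq_intros\<close>)
next
  case False
  have "((\<lambda>t. poly p (z + t * b) / b) has_field_derivative poly (pderiv p) z) (at 0)"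
    using False
    by (auto intro!: derivative_eq_intros DERIV_chain'[OF _ poly_DERIV])
  moreover have "poly p z / b = a"
    using assms False by (simp add: field_simps)
  ultimately show ?thesis
    using False by (intro exI[of _ "\<lambda>t. poly p (z + t * b) / b"]) auto
qed

lemma D1_restrict:
  assumes "F \<in> poly_funs affine_coords"
  shows "D1 p (restrict F (danielewski p)) = restrict (field1 p F) (danielewski p)"
  unfolding D1_def
proof (rule induced_restrict[OF _ _ assms,
      where v = "\<lambda>q i. vector [poly (pderiv p) (q $ 3), 0, q $ 2] $ i"])
  fix q assume "q \<in> danielewski p"
  then obtain g where "g 0 = q $ 1" "\<And>t. g t * q $ 2 = poly p (q $ 3 + t * q $ 2)"
      "(g has_field_derivative poly (pderiv p) (q $ 3)) (at 0)"
    using danielewski_curve[of "q $ 1" "q $ 2" p "q $ 3"] by (auto simp: danielewski_def)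
  then show "\<exists>c. c 0 = q \<and> (\<forall>t. c t \<in> danielewski p) \<and>
      (\<forall>i. ((\<lambda>t. c t $ i) has_field_derivative
         vector [poly (pderiv p) (q $ 3), 0, q $ 2] $ i) (at 0))"
    by (intro exI[of _ "\<lambda>t. vector [g t, q $ 2, q $ 3 + t * q $ 2]"])
       (auto simp: danielewski_def vec_eq_iff forall_3 intro!: derivative_eq_intros)
qed (simp add: field1_def sum_3)

lemma D2_restrict:
  assumes "F \<in> poly_funs affine_coords"
  shows "D2 p (restrict F (danielewski p)) = restrict (field2 p F) (danielewski p)"
  unfolding D2_def
proof (rule induced_restrict[OF _ _ assms,
      where v = "\<lambda>q i. vector [0, poly (pderiv p) (q $ 3), q $ 1] $ i"])
  fix q assume "q \<in> danielewski p"
  then obtain g where "g 0 = q $ 2" "\<And>t. g t * q $ 1 = poly p (q $ 3 + t * q $ 1)"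
      "(g has_field_derivative poly (pderiv p) (q $ 3)) (at 0)"
    using danielewski_curve[of "q $ 2" "q $ 1" p "q $ 3"]
    by (auto simp: danielewski_def mult.commute)
  then show "\<exists>c. c 0 = q \<and> (\<forall>t. c t \<in> danielewski p) \<and>
      (\<forall>i. ((\<lambda>t. c t $ i) has_field_derivative
         vector [0, poly (pderiv p) (q $ 3), q $ 1] $ i) (at 0))"
    by (intro exI[of _ "\<lambda>t. vector [q $ 1, g t, q $ 3 + t * q $ 1]"])
       (auto simp: danielewski_def vec_eq_iff forall_3 mult.commute intro!: derivative_eq_intros)
qed (simp add: field2_def sum_3)

end

(*
  The flows of D1 and D3 are the shears z -> z + c y with c = t and c = t y, and those of D2 and D4
  are their images under exchanging x and y. All of them are polynomial automorphisms of the ambient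
  space preserving the Poisson bracket {y,z} = y, {x,z} = -x, {y,x} = p'(z), for which D1 and D3 are
  the Hamiltonian fields of y and y^2/2. The functions whose Hamiltonian field is the velocity of a
  polynomial family in the group form a vector space invariant under the group, hence invariant under
  the derivations. Starting from y, the derivations D2 and D3 produce y^(1+je) and y^(je) p'(z) for
  all j, where e = 2 nu - 3. By interpolation their fields span the tangent space of Y^m at every
  tuple with nonzero y_i, distinct y_i^e and nonzero p''(z_i). So the orbits are open in this Zariski
  open set in the analytic topology; since the set is connected, it lies in a single orbit, which is
  then the union of its translates and thereby Zariski open.
*)

theory Submission
  imports Defs
begin

text \<open>The group is given by four flows only, while interpolation calls for fields with
  arbitrarily high powers of y, whose own flows are not at hand. Hence no one-parameter group is
  asked for: a field counts as soon as it is the velocity at time 0 of a polynomial family of group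
  elements. This suffices, since a product of such families with independent times is locally
  surjective onto a neighbourhood of a generic tuple. The weaker notion survives sums, because
  families can be composed, and conjugation by group elements. Invariance under derivations is then
  pure algebra: if E is a flow in the group, H o E_s lies in the space for every s and is polynomial
  in s, so combinations of finitely many values recover each coefficient, and the linear one is the
  derivative of H along E. Origin of e: \<open>D2\<close> lowers the exponent of y by one and
  creates p'(z), of degree \<nu> - 1; each \<open>D3\<close> raises it by two and differentiates in
  z. After \<nu> - 1 of these a constant is left, and the exponent has grown by 2(\<nu> - 1) - 1.
  The interpolation runs over this progression, hence through the values y_i^e.\<close>

section \<open>Polynomial functions\<close>

lemma poly_funs_subst:
  assumes "f \<in> poly_funs B" and "\<And>b. b \<in> B \<Longrightarrow> (\<lambda>q. b (\<phi> q)) \<in> poly_funs B'"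
  shows "(\<lambda>q. f (\<phi> q)) \<in> poly_funs B'"
  using assms(1) by induction (auto intro: assms(2) poly_funs.intros)

lemma poly_funs_affine_subst:
  assumes "F \<in> poly_funs affine_coords" and "\<And>i. (\<lambda>q. \<Phi> q $ i) \<in> poly_funs B"
  shows "(\<lambda>q. F (\<Phi> q)) \<in> poly_funs B"
  using assms(1) by (rule poly_funs_subst) (auto simp: affine_coords_def assms(2))

lemma poly_funs_nth: "(\<lambda>q. q $ i) \<in> poly_funs affine_coords"
  by (rule poly_funs.coord) (auto simp: affine_coords_def)

lemma poly_funs_uminus: "f \<in> poly_funs B \<Longrightarrow> (\<lambda>q. - f q) \<in> poly_funs B"
  using poly_funs.mult[OF poly_funs.const[of "-1"]] by fastforce

lemma poly_funs_diff:
  "f \<in> poly_funs B \<Longrightarrow> g \<in> poly_funs B \<Longrightarrow> (\<lambda>q. f q - g q) \<in> poly_funs B"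
  using poly_funs.add[OF _ poly_funs_uminus, of f B g] by simp

lemma poly_funs_sum:
  "(\<And>i. i \<in> A \<Longrightarrow> f i \<in> poly_funs B) \<Longrightarrow> (\<lambda>q. \<Sum>i\<in>A. f i q) \<in> poly_funs B"
  by (induction A rule: infinite_finite_induct) (auto intro: poly_funs.intros)

lemma poly_funs_prod:
  "(\<And>i. i \<in> A \<Longrightarrow> f i \<in> poly_funs B) \<Longrightarrow> (\<lambda>q. \<Prod>i\<in>A. f i q) \<in> poly_funs B"
  by (induction A rule: infinite_finite_induct) (auto intro: poly_funs.intros)

lemma poly_funs_power: "f \<in> poly_funs B \<Longrightarrow> (\<lambda>q. f q ^ n) \<in> poly_funs B"
  by (induction n) (auto intro: poly_funs.intros)

lemma poly_funs_poly: "f \<in> poly_funs B \<Longrightarrow> (\<lambda>q. poly P (f q)) \<in> poly_funs B"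
  by (induction P) (auto intro: poly_funs.intros)

lemmas poly_funs_intros =
  poly_funs.const poly_funs.add poly_funs.mult poly_funs_nth poly_funs_uminus poly_funs_diff
  poly_funs_sum poly_funs_prod poly_funs_power poly_funs_poly

lemma coord_ringE:
  assumes "f \<in> coord_ring X"
  obtains F where "F \<in> poly_funs affine_coords" "f = restrict F X"
  using assms by (auto simp: coord_ring_def)

lemma coord_ringI: "F \<in> poly_funs affine_coords \<Longrightarrow> restrict F X \<in> coord_ring X"
  by (auto simp: coord_ring_def)


section \<open>The automorphism group\<close>

text \<open>The coordinates of \<open>\<phi>\<close> are known only on X. An extension by
  polynomials of the ambient space turns composition with \<open>\<phi>\<close> into
  substitution.\<close>

lemma regular_map_polynomial:
  assumes "regular_map X \<phi>"
  obtains \<Phi> where "\<And>i. (\<lambda>q. \<Phi> q $ i) \<in> poly_funs affine_coords" "\<And>q. q \<in> X \<Longrightarrow> \<Phi> q = \<phi> q"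
proof -
  have "\<forall>i. \<exists>F. F \<in> poly_funs affine_coords \<and> (\<lambda>q\<in>X. \<phi> q $ i) = restrict F X"
    using assms unfolding regular_map_def by (meson coord_ringE)
  then obtain F where F: "\<And>i. F i \<in> poly_funs affine_coords"
      "\<And>i. (\<lambda>q\<in>X. \<phi> q $ i) = restrict (F i) X"
    by metis
  show ?thesis
  proof (rule that[of "\<lambda>q. \<chi> i. F i q"])
    fix q assume "q \<in> X"
    then have "F i q = \<phi> q $ i" for i
      using fun_cong[OF F(2)[of i], of q] by simp
    then show "(\<chi> i. F i q) = \<phi> q"
      by (simp add: vec_eq_iff)
  qed (simp add: F(1))
qed

lemma regular_mapI:
  assumes "\<And>i. (\<lambda>q. \<Phi> q $ i) \<in> poly_funs affine_coords" "\<And>q. q \<in> X \<Longrightarrow> \<Phi> q \<in> X"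
    and "\<And>q. q \<in> X \<Longrightarrow> \<phi> q = \<Phi> q"
  shows "regular_map X \<phi>"
proof -
  have "(\<lambda>q\<in>X. \<phi> q $ i) = restrict (\<lambda>q. \<Phi> q $ i) X" for i
    using assms(3) by auto
  then show ?thesis
    using assms by (auto simp: regular_map_def coord_ringI)
qed

lemma regular_map_compose:
  assumes "regular_map X \<phi>" "regular_map X \<psi>"
  shows "regular_map X (compose X \<phi> \<psi>)"
proof -
  obtain \<Phi> where \<Phi>: "\<And>i. (\<lambda>q. \<Phi> q $ i) \<in> poly_funs affine_coords" "\<And>q. q \<in> X \<Longrightarrow> \<Phi> q = \<phi> q"
    using regular_map_polynomial[OF assms(1)] by blast
  obtain \<Psi> where \<Psi>: "\<And>i. (\<lambda>q. \<Psi> q $ i) \<in> poly_funs affine_coords" "\<And>q. q \<in> X \<Longrightarrow> \<Psi> q = \<psi> q"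
    using regular_map_polynomial[OF assms(2)] by blast
  have closed: "\<phi> q \<in> X" "\<psi> q \<in> X" if "q \<in> X" for q
    using assms that by (auto simp: regular_map_def)
  show ?thesis
    by (rule regular_mapI[of "\<lambda>q. \<Phi> (\<Psi> q)"])
      (auto simp: \<Phi>(2) \<Psi>(2) closed compose_def intro: poly_funs_affine_subst[OF \<Phi>(1) \<Psi>(1)])
qed

lemma subgroup_aut_group: "subgroup (carrier (aut_group X)) (BijGroup X)"
proof -
  let ?A = "carrier (aut_group X)"
  interpret B: group "BijGroup X" by (rule group_BijGroup)
  have A: "\<phi> \<in> ?A \<longleftrightarrow> \<phi> \<in> Bij X \<and> regular_map X \<phi> \<and> regular_map X (restrict (inv_into X \<phi>) X)" for \<phi>
    by (simp add: aut_group_def)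
  have carrier: "carrier (BijGroup X) = Bij X"
    by (simp add: BijGroup_def)
  have inv: "inv\<^bsub>BijGroup X\<^esub> \<phi> = restrict (inv_into X \<phi>) X" if "\<phi> \<in> Bij X" for \<phi>
    using inv_BijGroup[OF that] by simp
  have mult: "\<phi> \<otimes>\<^bsub>BijGroup X\<^esub> \<psi> = compose X \<phi> \<psi>" if "\<phi> \<in> Bij X" "\<psi> \<in> Bij X" for \<phi> \<psi>
    using that by (simp add: BijGroup_def)
  \<comment> \<open>In terms of the group inverse the condition is symmetric in
    \<open>\<phi>\<close> and its inverse, so closure under inversion is immediate and closure under
    products comes from \<open>regular_map_compose\<close>.\<close>
  have A_inv: "\<phi> \<in> ?A \<longleftrightarrow> \<phi> \<in> Bij X \<and> regular_map X \<phi> \<and> regular_map X (inv\<^bsub>BijGroup X\<^esub> \<phi>)" for \<phi>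
    using A inv by auto
  show ?thesis
  proof (rule B.subgroupI)
    show "?A \<subseteq> carrier (BijGroup X)"
      using A carrier by auto
    have one: "\<one>\<^bsub>BijGroup X\<^esub> = (\<lambda>q\<in>X. q)"
      by (simp add: BijGroup_def)
    have "regular_map X (\<lambda>q\<in>X. q)"
      by (rule regular_mapI[of "\<lambda>q. q"]) (auto intro: poly_funs_nth)
    then have "\<one>\<^bsub>BijGroup X\<^esub> \<in> ?A"
      unfolding A_inv B.inv_one using id_Bij by (simp add: one)
    then show "?A \<noteq> {}"
      by blast
  next
    fix \<phi> assume \<phi>: "\<phi> \<in> ?A"
    then have "\<phi> \<in> carrier (BijGroup X)"
      using A carrier by auto
    then have "inv\<^bsub>BijGroup X\<^esub> (inv\<^bsub>BijGroup X\<^esub> \<phi>) = \<phi>" "inv\<^bsub>BijGroup X\<^esub> \<phi> \<in> Bij X"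
      using B.inv_closed carrier by auto
    then show "inv\<^bsub>BijGroup X\<^esub> \<phi> \<in> ?A"
      using \<phi> unfolding A_inv by simp
  next
    fix \<phi> \<psi> assume h: "\<phi> \<in> ?A" "\<psi> \<in> ?A"
    then have b: "\<phi> \<in> Bij X" "\<psi> \<in> Bij X" and b': "\<phi> \<in> carrier (BijGroup X)" "\<psi> \<in> carrier (BijGroup X)"
      using A carrier by auto
    have ib: "inv\<^bsub>BijGroup X\<^esub> \<phi> \<in> Bij X" "inv\<^bsub>BijGroup X\<^esub> \<psi> \<in> Bij X"
      using B.inv_closed b' carrier by auto
    show "\<phi> \<otimes>\<^bsub>BijGroup X\<^esub> \<psi> \<in> ?A"
    proof (rule A_inv[THEN iffD2], intro conjI)
      show "\<phi> \<otimes>\<^bsub>BijGroup X\<^esub> \<psi> \<in> Bij X"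
        unfolding mult[OF b] by (rule compose_Bij[OF b])
      have "regular_map X \<phi>" "regular_map X \<psi>" "regular_map X (inv\<^bsub>BijGroup X\<^esub> \<phi>)"
          "regular_map X (inv\<^bsub>BijGroup X\<^esub> \<psi>)"
        using h A_inv by blast+
      then have "regular_map X (compose X \<phi> \<psi>)"
          "regular_map X (compose X (inv\<^bsub>BijGroup X\<^esub> \<psi>) (inv\<^bsub>BijGroup X\<^esub> \<phi>))"
        by (auto intro: regular_map_compose)
      then show "regular_map X (\<phi> \<otimes>\<^bsub>BijGroup X\<^esub> \<psi>)"
          "regular_map X (inv\<^bsub>BijGroup X\<^esub> (\<phi> \<otimes>\<^bsub>BijGroup X\<^esub> \<psi>))"
        using mult[OF b] B.inv_mult_group[OF b'] mult[OF ib(2,1)] by metis+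
    qed
  qed
qed

lemma group_aut_group: "group (aut_group X)"
proof -
  interpret B: group "BijGroup X" by (rule group_BijGroup)
  have "aut_group X = (BijGroup X)\<lparr>carrier := carrier (aut_group X)\<rparr>"
    by (simp add: aut_group_def)
  then show ?thesis
    using B.subgroup_imp_group[OF subgroup_aut_group[of X]] by simp
qed

lemma mult_aut_group:
  "\<phi> \<in> carrier (aut_group X) \<Longrightarrow> \<psi> \<in> carrier (aut_group X) \<Longrightarrow>
     \<phi> \<otimes>\<^bsub>aut_group X\<^esub> \<psi> = compose X \<phi> \<psi>"
  by (simp add: aut_group_def BijGroup_def)

section \<open>The group generated by the flows\<close>

lemma flow_group_subset: "carrier (flow_group X \<D>) \<subseteq> carrier (aut_group X)"
  unfolding flow_group_def by (rule group.carrier_subgroup_generated_subset[OF group_aut_group])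

lemma group_flow_group: "group (flow_group X \<D>)"
  unfolding flow_group_def by (rule group.group_subgroup_generated[OF group_aut_group])

lemma flow_in_flow_group:
  assumes "\<phi> \<in> flow X D" "D \<in> \<D>"
  shows "\<phi> \<in> carrier (flow_group X \<D>)"
  unfolding flow_group_def carrier_subgroup_generated
  by (rule generate.incl) (use assms in \<open>auto simp: flow_def\<close>)

lemma mult_flow_group:
  assumes "\<phi> \<in> carrier (flow_group X \<D>)" "\<psi> \<in> carrier (flow_group X \<D>)"
  shows "\<phi> \<otimes>\<^bsub>flow_group X \<D>\<^esub> \<psi> = compose X \<phi> \<psi>"
proof -
  have "\<phi> \<otimes>\<^bsub>flow_group X \<D>\<^esub> \<psi> = \<phi> \<otimes>\<^bsub>aut_group X\<^esub> \<psi>"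
    by (simp add: flow_group_def subgroup_generated_def)
  then show ?thesis
    using assms flow_group_subset[of X \<D>] mult_aut_group[of \<phi> X \<psi>] by auto
qed

lemma one_flow_group: "\<one>\<^bsub>flow_group X \<D>\<^esub> = (\<lambda>q\<in>X. q)"
  by (simp add: flow_group_def aut_group_def BijGroup_def)

lemma flow_group_compose:
  assumes "\<phi> \<in> carrier (flow_group X \<D>)" "\<psi> \<in> carrier (flow_group X \<D>)"
  shows "compose X \<phi> \<psi> \<in> carrier (flow_group X \<D>)"
  using monoid.m_closed[OF group.is_monoid[OF group_flow_group] assms]
  by (simp add: mult_flow_group[OF assms])

lemma flow_group_inverse:
  assumes "\<phi> \<in> carrier (flow_group X \<D>)"
  obtains \<psi> where "\<psi> \<in> carrier (flow_group X \<D>)"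
    "\<And>q. q \<in> X \<Longrightarrow> \<psi> (\<phi> q) = q" "\<And>q. q \<in> X \<Longrightarrow> \<phi> (\<psi> q) = q"
proof -
  interpret group "flow_group X \<D>" by (rule group_flow_group)
  let ?\<psi> = "inv\<^bsub>flow_group X \<D>\<^esub> \<phi>"
  have \<psi>: "?\<psi> \<in> carrier (flow_group X \<D>)"
    using assms by simp
  have eq: "compose X \<phi> ?\<psi> = (\<lambda>q\<in>X. q)" "compose X ?\<psi> \<phi> = (\<lambda>q\<in>X. q)"
    using r_inv[OF assms] l_inv[OF assms]
    unfolding mult_flow_group[OF assms \<psi>] mult_flow_group[OF \<psi> assms] one_flow_group by auto
  show ?thesis
  proof (rule that[OF \<psi>])
    fix q assume "q \<in> X"
    then show "?\<psi> (\<phi> q) = q" "\<phi> (?\<psi> q) = q"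
      using fun_cong[OF eq(1), of q] fun_cong[OF eq(2), of q] by (simp_all add: compose_def)
  qed
qed

lemma flow_group_regular:
  assumes "\<phi> \<in> carrier (flow_group X \<D>)"
  shows "regular_map X \<phi>"
  using assms flow_group_subset[of X \<D>] by (auto simp: aut_group_def)

lemma flow_group_closed: "\<phi> \<in> carrier (flow_group X \<D>) \<Longrightarrow> q \<in> X \<Longrightarrow> \<phi> q \<in> X"
  using flow_group_regular[of \<phi> X \<D>] by (auto simp: regular_map_def)

lemma flow_group_restrict_compose:
  assumes "restrict f X \<in> carrier (flow_group X \<D>)" "restrict g X \<in> carrier (flow_group X \<D>)"
  shows "(\<lambda>q\<in>X. f (g q)) \<in> carrier (flow_group X \<D>)"
proof -
  have "g q \<in> X" if "q \<in> X" for q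
    using flow_group_closed[OF assms(2) that] that by simp
  then have "compose X (restrict f X) (restrict g X) = (\<lambda>q\<in>X. f (g q))"
    by (auto simp: compose_def)
  then show ?thesis
    using flow_group_compose[OF assms] by simp
qed

lemma flow_group_id: "(\<lambda>q\<in>X. q) \<in> carrier (flow_group X \<D>)"
  using group.is_monoid[OF group_flow_group[of X \<D>], THEN monoid.one_closed]
  by (simp add: one_flow_group)

lemma group_action_flow_group: "group_action (flow_group X \<D>) X (\<lambda>\<phi>. \<phi>)"
proof -
  have sub: "\<phi> \<in> Bij X" if "\<phi> \<in> carrier (flow_group X \<D>)" for \<phi>
    using that flow_group_subset[of X \<D>] by (auto simp: aut_group_def)
  have "(\<lambda>\<phi>. \<phi>) \<in> hom (flow_group X \<D>) (BijGroup X)"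
    by (auto simp: hom_def BijGroup_def sub mult_flow_group)
  then show ?thesis
    using group_flow_group group_BijGroup
    by (auto simp: group_action_def group_hom_def group_hom_axioms_def)
qed


section \<open>Polynomial flows\<close>

text \<open>Time and point are treated as joint variables: polynomiality at each fixed time alone
  would not make the dependence on time polynomial.\<close>

definition time_coords :: "(complex \<times> (complex ^ 'n) \<Rightarrow> complex) set" where
  "time_coords = insert fst {\<lambda>r. snd r $ i | i. True}"

lemma time_coordsE:
  assumes "b \<in> time_coords"
  obtains "b = fst" | i where "b = (\<lambda>r. snd r $ i)"
  using assms by (auto simp: time_coords_def)

lemma poly_funs_fst: "fst \<in> poly_funs time_coords"
  by (rule poly_funs.coord) (simp add: time_coords_def)

lemma poly_funs_snd: "(\<lambda>r. snd r $ i) \<in> poly_funs time_coords"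
  by (rule poly_funs.coord) (auto simp: time_coords_def)

text \<open>The bound N is uniform in q. It gives one exponent of nilpotency for a whole function,
  and one finite list of coefficients that are themselves functions of q.\<close>

lemma poly_funs_time_expand:
  assumes "f \<in> poly_funs time_coords"
  obtains P N where "\<And>q. degree (P q) \<le> N"
    "\<And>i. (\<lambda>q. coeff (P q) i) \<in> poly_funs affine_coords" "\<And>s q. f (s, q) = poly (P q) s"
proof -
  have "\<exists>P N. (\<forall>q. degree (P q) \<le> N) \<and>
      (\<forall>i. (\<lambda>q. coeff (P q) i) \<in> poly_funs affine_coords) \<and> (\<forall>s q. f (s, q) = poly (P q) s)"
    using assms
  proof induction
    case (coord b)
    then consider "b = fst" | i where "b = (\<lambda>r. snd r $ i)"
      by (auto simp: time_coords_def)
    then show ?case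
    proof cases
      case 1
      then show ?thesis
        by (intro exI[of _ "\<lambda>_. [:0, 1:]"] exI[of _ 1]) (auto intro: poly_funs.const)
    next
      case (2 i)
      have "(\<lambda>q. coeff [:q $ i:] k) \<in> poly_funs affine_coords" for k
        by (cases k) (auto intro: poly_funs_intros)
      then show ?thesis
        using 2 by (intro exI[of _ "\<lambda>q. [:q $ i:]"] exI[of _ 0]) auto
    qed
  next
    case (const c)
    then show ?case
      by (intro exI[of _ "\<lambda>_. [:c:]"] exI[of _ 0]) (auto intro: poly_funs.const)
  next
    case (add f g)
    then obtain P N P' N' where
      "\<forall>q. degree (P q) \<le> N" "\<forall>q. degree (P' q) \<le> N'"
      "\<forall>i. (\<lambda>q. coeff (P q) i) \<in> poly_funs affine_coords"
      "\<forall>i. (\<lambda>q. coeff (P' q) i) \<in> poly_funs affine_coords"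
      "\<forall>s q. f (s, q) = poly (P q) s" "\<forall>s q. g (s, q) = poly (P' q) s"
      by blast
    then show ?case
      by (intro exI[of _ "\<lambda>q. P q + P' q"] exI[of _ "max N N'"])
        (auto intro!: degree_add_le poly_funs.add intro: max.coboundedI1 max.coboundedI2)
  next
    case (mult f g)
    then obtain P N P' N' where P:
      "\<forall>q. degree (P q) \<le> N" "\<forall>q. degree (P' q) \<le> N'"
      "\<forall>i. (\<lambda>q. coeff (P q) i) \<in> poly_funs affine_coords"
      "\<forall>i. (\<lambda>q. coeff (P' q) i) \<in> poly_funs affine_coords"
      "\<forall>s q. f (s, q) = poly (P q) s" "\<forall>s q. g (s, q) = poly (P' q) s"
      by blast
    have "degree (P q * P' q) \<le> N + N'" for q
      using degree_mult_le[of "P q" "P' q"] P(1,2) by (meson add_mono order_trans)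
    then show ?case
      using P by (intro exI[of _ "\<lambda>q. P q * P' q"] exI[of _ "N + N'"])
        (auto simp: coeff_mult intro!: poly_funs_sum poly_funs.mult)
  qed
  then show ?thesis
    using that by blast
qed

lemma poly_higher_pderiv_0: "poly ((pderiv ^^ k) P) 0 = fact k * coeff P k"
  for P :: "'a :: {comm_semiring_1,semiring_no_zero_divisors,semiring_char_0} poly"
proof (induction k arbitrary: P)
  case 0
  then show ?case by (simp add: poly_0_coeff_0)
next
  case (Suc k)
  have "poly ((pderiv ^^ Suc k) P) 0 = poly ((pderiv ^^ k) (pderiv P)) 0"
    by (simp add: funpow_swap1)
  then show ?case
    by (simp add: Suc coeff_pderiv algebra_simps)
qed

lemma higher_pderiv_eq_0: "degree P < k \<Longrightarrow> (pderiv ^^ k) P = 0"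
  for P :: "complex poly"
proof (induction k arbitrary: P)
  case (Suc k)
  have "(pderiv ^^ k) (pderiv P) = 0"
  proof (cases "degree P = 0")
    case True
    have "(pderiv ^^ k) 0 = (0 :: complex poly)"
      by (induction k) auto
    then show ?thesis
      using True by (simp add: pderiv_eq_0_iff[THEN iffD2])
  next
    case False
    then show ?thesis
      using Suc by (simp add: degree_pderiv)
  qed
  then show ?case
    by (simp only: funpow.simps funpow_swap1 o_apply)
qed simp

definition lie_deriv ::
    "(complex \<Rightarrow> complex ^ 'n \<Rightarrow> complex ^ 'n) \<Rightarrow> (complex ^ 'n \<Rightarrow> complex) \<Rightarrow> complex ^ 'n \<Rightarrow> complex"
  where "lie_deriv E F q = deriv (\<lambda>s. F (E s q)) 0"

text \<open>The group law is required on the whole ambient space, and X only has to be preserved. So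
  Lie derivatives are computed for ambient polynomials and restricted to X at the end.\<close>

locale polynomial_flow =
  fixes X :: "(complex ^ 'n) set" and E :: "complex \<Rightarrow> complex ^ 'n \<Rightarrow> complex ^ 'n"
  assumes polynomial: "(\<lambda>r. E (fst r) (snd r) $ i) \<in> poly_funs time_coords"
    and flow_add: "E (s + t) q = E s (E t q)"
    and flow_0: "E 0 q = q"
    and flow_closed: "q \<in> X \<Longrightarrow> E t q \<in> X"
begin

lemma polynomial_at: "(\<lambda>q. E t q $ i) \<in> poly_funs affine_coords"
proof -
  have "(\<lambda>q. (\<lambda>r. E (fst r) (snd r) $ i) (t, q)) \<in> poly_funs affine_coords"
    by (rule poly_funs_subst[OF polynomial])
      (auto simp: time_coords_def intro: poly_funs_intros)
  then show ?thesis by simp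
qed

lemma flow_inverse: "E (- t) (E t q) = q" "E t (E (- t) q) = q"
  using flow_add[of "- t" t q] flow_add[of t "- t" q] by (simp_all add: flow_0)

lemma flow_expand:
  assumes "F \<in> poly_funs affine_coords"
  obtains P N where "\<And>q. degree (P q) \<le> N"
    "\<And>i. (\<lambda>q. coeff (P q) i) \<in> poly_funs affine_coords" "\<And>s q. F (E s q) = poly (P q) s"
proof -
  have "(\<lambda>r. F (E (fst r) (snd r))) \<in> poly_funs time_coords"
    by (rule poly_funs_affine_subst[OF assms polynomial])
  then obtain P N where "\<And>q. degree (P q) \<le> N"
    "\<And>i. (\<lambda>q. coeff (P q) i) \<in> poly_funs affine_coords"
    "\<And>s q. F (E (fst (s, q)) (snd (s, q))) = poly (P q) s"
    by (rule poly_funs_time_expand) blast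
  then show ?thesis
    by (intro that[of P N]) simp_all
qed

lemma
  assumes "F \<in> poly_funs affine_coords"
  shows has_lie_deriv: "((\<lambda>s. F (E s q)) has_field_derivative lie_deriv E F q) (at 0)"
    and lie_deriv_poly_fun: "lie_deriv E F \<in> poly_funs affine_coords"
proof -
  obtain P N where P: "\<And>q. degree (P q) \<le> N"
    "\<And>i. (\<lambda>q. coeff (P q) i) \<in> poly_funs affine_coords" "\<And>s q. F (E s q) = poly (P q) s"
    using flow_expand[OF assms] by blast
  have D: "((\<lambda>s. F (E s q)) has_field_derivative poly (pderiv (P q)) 0) (at 0)" for q
    unfolding P(3) by (rule poly_DERIV)
  then have eq: "lie_deriv E F q = poly (pderiv (P q)) 0" for q
    by (simp add: lie_deriv_def DERIV_imp_deriv)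
  show "((\<lambda>s. F (E s q)) has_field_derivative lie_deriv E F q) (at 0)"
    using D by (simp add: eq)
  have "lie_deriv E F = (\<lambda>q. coeff (P q) 1)"
    by (simp add: fun_eq_iff eq poly_0_coeff_0 coeff_pderiv)
  then show "lie_deriv E F \<in> poly_funs affine_coords"
    using P(2) by simp
qed

lemma lie_deriv_iterate_poly_fun:
  "F \<in> poly_funs affine_coords \<Longrightarrow> (lie_deriv E ^^ k) F \<in> poly_funs affine_coords"
  by (induction k) (auto intro: lie_deriv_poly_fun)

text \<open>By \<open>flow_add\<close>, the Lie derivative at \<open>E t q\<close> is the ordinary
  derivative in t along the orbit of q. Iterating it therefore differentiates the polynomial
  P.\<close>

lemma lie_deriv_iterate:
  assumes F: "F \<in> poly_funs affine_coords" and P: "\<And>s. F (E s q) = poly P s"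
  shows "(lie_deriv E ^^ k) F (E t q) = poly ((pderiv ^^ k) P) t"
proof (induction k arbitrary: t)
  case (Suc k)
  let ?G = "(lie_deriv E ^^ k) F"
  have "((\<lambda>s. ?G (E s (E t q))) has_field_derivative lie_deriv E ?G (E t q)) (at 0)"
    by (rule has_lie_deriv[OF lie_deriv_iterate_poly_fun[OF F]])
  moreover have "((\<lambda>s. ?G (E s (E t q))) has_field_derivative poly (pderiv ((pderiv ^^ k) P)) t) (at 0)"
  proof -
    have "((\<lambda>s. poly ((pderiv ^^ k) P) (s + t)) has_field_derivative
        poly (pderiv ((pderiv ^^ k) P)) t) (at 0)"
      using DERIV_shift[of "poly ((pderiv ^^ k) P)" _ 0 t, THEN iffD1] poly_DERIV[of "(pderiv ^^ k) P" t]
      by (simp del: funpow.simps)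
    then show ?thesis
      by (simp add: Suc flow_add[symmetric])
  qed
  ultimately have "lie_deriv E ?G (E t q) = poly (pderiv ((pderiv ^^ k) P)) t"
    by (rule DERIV_unique)
  then show ?case by simp
qed (simp add: P)

lemma flow_aut: "restrict (E t) X \<in> carrier (aut_group X)"
proof -
  have reg: "regular_map X (restrict (E t) X)" for t
    by (rule regular_mapI[of "E t"]) (auto intro: polynomial_at flow_closed)
  have bij: "bij_betw (E t) X X"
    by (rule bij_betw_byWitness[of _ "E (- t)"]) (auto simp: flow_inverse flow_closed)
  have bij': "bij_betw (restrict (E t) X) X X"
    using bij by (simp cong: bij_betw_cong)
  have "restrict (inv_into X (restrict (E t) X)) X = restrict (E (- t)) X"
  proof (rule restrict_ext)
    fix q assume "q \<in> X"
    then have "E (- t) q \<in> X" "restrict (E t) X (E (- t) q) = q"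
      by (auto simp: flow_closed flow_inverse)
    then show "inv_into X (restrict (E t) X) q = E (- t) q"
      using bij_betw_imp_inj_on[OF bij'] by (metis inv_into_f_f)
  qed
  then show ?thesis
    using reg bij' by (auto simp: aut_group_def Bij_def)
qed

context
  fixes D :: "(complex ^ 'n \<Rightarrow> complex) \<Rightarrow> (complex ^ 'n \<Rightarrow> complex)"
  assumes D: "\<And>F. F \<in> poly_funs affine_coords \<Longrightarrow> D (restrict F X) = restrict (lie_deriv E F) X"
begin

lemma generator_iterate:
  "F \<in> poly_funs affine_coords \<Longrightarrow> (D ^^ k) (restrict F X) = restrict ((lie_deriv E ^^ k) F) X"
  by (induction k) (auto simp: D lie_deriv_iterate_poly_fun)

lemma generator_derivation: "derivation X D"
  unfolding derivation_def
proof (intro conjI ballI allI)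
  fix f assume "f \<in> coord_ring X"
  then obtain F where F: "F \<in> poly_funs affine_coords" "f = restrict F X"
    by (rule coord_ringE)
  then show "D f \<in> coord_ring X"
    by (auto simp: D intro!: coord_ringI lie_deriv_poly_fun)
  fix c
  have "lie_deriv E (\<lambda>q. c * F q) q = c * lie_deriv E F q" for q
    unfolding lie_deriv_def[of E "\<lambda>q. c * F q"]
    by (rule DERIV_imp_deriv) (intro DERIV_cmult has_lie_deriv F(1))
  moreover have "(\<lambda>q\<in>X. c * f q) = restrict (\<lambda>q. c * F q) X"
    by (auto simp: F(2))
  ultimately show "D (\<lambda>q\<in>X. c * f q) = (\<lambda>q\<in>X. c * D f q)"
    by (auto simp: F D poly_funs_intros)
next
  fix f g assume "f \<in> coord_ring X" "g \<in> coord_ring X"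
  then obtain F G where F: "F \<in> poly_funs affine_coords" "f = restrict F X"
    and G: "G \<in> poly_funs affine_coords" "g = restrict G X"
    by (metis coord_ringE)
  have "lie_deriv E (\<lambda>q. F q + G q) q = lie_deriv E F q + lie_deriv E G q" for q
    unfolding lie_deriv_def[of E "\<lambda>q. F q + G q"]
    by (rule DERIV_imp_deriv) (intro DERIV_add has_lie_deriv F(1) G(1))
  moreover have "(\<lambda>q\<in>X. f q + g q) = restrict (\<lambda>q. F q + G q) X"
    by (auto simp: F(2) G(2))
  ultimately show "D (\<lambda>q\<in>X. f q + g q) = (\<lambda>q\<in>X. D f q + D g q)"
    by (auto simp: F G D poly_funs_intros)
  have "lie_deriv E (\<lambda>q. F q * G q) q = lie_deriv E F q * G q + F q * lie_deriv E G q" for q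
    unfolding lie_deriv_def[of E "\<lambda>q. F q * G q"]
    using DERIV_mult[OF has_lie_deriv[OF F(1)] has_lie_deriv[OF G(1)], of q]
    by (intro DERIV_imp_deriv) (simp add: flow_0 ac_simps)
  moreover have "(\<lambda>q\<in>X. f q * g q) = restrict (\<lambda>q. F q * G q) X"
    by (auto simp: F(2) G(2))
  ultimately show "D (\<lambda>q\<in>X. f q * g q) = (\<lambda>q\<in>X. D f q * g q + f q * D g q)"
    by (auto simp: F G D poly_funs_intros)
qed

lemma generator_locally_nilpotent: "locally_nilpotent_derivation X D"
  unfolding locally_nilpotent_derivation_def
proof (intro conjI ballI generator_derivation)
  fix f assume "f \<in> coord_ring X"
  then obtain F where F: "F \<in> poly_funs affine_coords" "f = restrict F X"
    by (rule coord_ringE)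
  obtain P N where P: "\<And>q. degree (P q) \<le> N" "\<And>s q. F (E s q) = poly (P q) s"
    using flow_expand[OF F(1)] by metis
  \<comment> \<open>Along each orbit F is a polynomial of degree at most N in the time, so N + 1
    derivatives annihilate it.\<close>
  have "(lie_deriv E ^^ Suc N) F q = 0" for q
    using lie_deriv_iterate[OF F(1) P(2), where t = 0 and k = "Suc N" and q = q] P(1)[of q]
    by (simp add: flow_0 higher_pderiv_eq_0 less_Suc_eq_le del: funpow.simps)
  then have "restrict ((lie_deriv E ^^ Suc N) F) X = (\<lambda>q\<in>X. 0)"
    by (intro restrict_ext) (simp del: funpow.simps)
  then show "\<exists>k. (D ^^ k) f = (\<lambda>q\<in>X. 0)"
    unfolding F(2) generator_iterate[OF F(1), symmetric] by blast
qed

text \<open>The exponential series is the Taylor expansion at time 0 of the polynomial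
  \<open>P q\<close>, evaluated at t.\<close>

lemma generator_flow: "restrict (E t) X \<in> flow X D"
  unfolding flow_def
proof (intro CollectI conjI flow_aut exI[of _ t] ballI)
  fix f assume "f \<in> coord_ring X"
  then obtain F where F: "F \<in> poly_funs affine_coords" "f = restrict F X"
    by (rule coord_ringE)
  obtain P N where P: "\<And>q. degree (P q) \<le> N" "\<And>s q. F (E s q) = poly (P q) s"
    using flow_expand[OF F(1)] by metis
  have "(\<Sum>k. t ^ k / fact k * (D ^^ k) f q) = F (E t q)" if q: "q \<in> X" for q
  proof -
    have *: "(D ^^ k) f q = fact k * coeff (P q) k" for k
      using lie_deriv_iterate[OF F(1) P(2), where t = 0 and k = k and q = q] q
      by (simp add: F(2) generator_iterate[OF F(1)] flow_0 poly_higher_pderiv_0)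
    have "(\<Sum>k. t ^ k / fact k * (D ^^ k) f q) = (\<Sum>k. coeff (P q) k * t ^ k)"
      by (simp add: * mult.commute)
    also have "\<dots> = (\<Sum>k\<le>degree (P q). coeff (P q) k * t ^ k)"
      by (rule suminf_finite) (auto simp: coeff_eq_0)
    finally show ?thesis
      by (simp add: P(2) poly_altdef)
  qed
  then show "(\<lambda>q\<in>X. f (restrict (E t) X q)) = exp_derivation X D t f"
    by (auto simp: exp_derivation_def F(2) flow_closed)
qed

end

end


section \<open>The flows on the Danielewski surface\<close>

text \<open>The difference quotient (p(z + h) - p(z)) / h, written as a polynomial in z and h so
  that it makes sense at h = 0.\<close>

definition diff_quot :: "complex poly \<Rightarrow> complex \<Rightarrow> complex \<Rightarrow> complex" where
  "diff_quot p z h = (\<Sum>n\<le>degree p. coeff p n * (\<Sum>i<n. z ^ (n - Suc i) * (z + h) ^ i))"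

lemma diff_quot: "poly p (z + h) = poly p z + h * diff_quot p z h"
proof -
  have "(z + h) ^ n - z ^ n = h * (\<Sum>i<n. z ^ (n - Suc i) * (z + h) ^ i)" for n
    using power_diff_sumr2[of "z + h" n z] by simp
  then have "poly p (z + h) - poly p z = h * diff_quot p z h"
    unfolding poly_altdef diff_quot_def sum_subtractf[symmetric] sum_distrib_left[of h "\<lambda>n. coeff p n * _ n"]
    by (intro sum.cong) (simp_all only: right_diff_distrib[symmetric] mult.left_commute)
  then show ?thesis by (simp add: algebra_simps)
qed

lemma diff_quot_poly_fun:
  "f \<in> poly_funs B \<Longrightarrow> g \<in> poly_funs B \<Longrightarrow> (\<lambda>q. diff_quot p (f q) (g q)) \<in> poly_funs B"
  unfolding diff_quot_def by (intro poly_funs_intros)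

lemma diff_quot_differentiable:
  "(\<lambda>h. diff_quot p z h) field_differentiable at h"
  "(\<lambda>z. diff_quot p z h) field_differentiable at z"
  unfolding diff_quot_def
  by (intro field_differentiable_sum field_differentiable_mult field_differentiable_const
      field_differentiable_power field_differentiable_add field_differentiable_ident)+

text \<open>Differentiating both sides of \<open>diff_quot\<close> in h at 0 leaves the quotient
  itself on one side, because its own derivative is multiplied by h = 0.\<close>

lemma diff_quot_0: "diff_quot p z 0 = poly (pderiv p) z"
proof -
  obtain d where "((\<lambda>h. diff_quot p z h) has_field_derivative d) (at 0)"
    using diff_quot_differentiable(1)[unfolded field_differentiable_def] by blast
  then have "((\<lambda>h. poly p z + h * diff_quot p z h) has_field_derivative diff_quot p z 0) (at 0)"
    by (auto intro!: derivative_eq_intros)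
  moreover have "((\<lambda>h. poly p (z + h)) has_field_derivative poly (pderiv p) z) (at 0)"
    by (auto intro!: derivative_eq_intros DERIV_chain'[OF _ poly_DERIV])
  ultimately show ?thesis
    unfolding diff_quot by (rule DERIV_unique)
qed

text \<open>The composition law of shears in the coordinate x. Multiplied by y, both sides are p(z +
  (s + t) y) - p(z); for y = 0, where y cannot be cancelled, every quotient is p'(z).\<close>

lemma diff_quot_add:
  "t * diff_quot p z (t * y) + s * diff_quot p (z + t * y) (s * y) = (s + t) * diff_quot p z ((s + t) * y)"
proof (cases "y = 0")
  case True
  then show ?thesis by (simp add: diff_quot_0 algebra_simps)
next
  case False
  have "poly p z + y * ((s + t) * diff_quot p z ((s + t) * y)) = poly p (z + t * y + s * y)"
    using diff_quot[of p z "(s + t) * y"] by (simp add: algebra_simps)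
  also have "\<dots> = poly p z + y * (t * diff_quot p z (t * y) + s * diff_quot p (z + t * y) (s * y))"
    using diff_quot[of p z "t * y"] diff_quot[of p "z + t * y" "s * y"] by (simp add: algebra_simps)
  finally show ?thesis
    using False by simp
qed

lemma vec3_eqI: "a $ 1 = b $ 1 \<Longrightarrow> a $ 2 = b $ 2 \<Longrightarrow> a $ 3 = b $ 3 \<Longrightarrow> a = b" for a b :: "'a ^ 3"
  by (simp add: vec_eq_iff forall_3)

text \<open>The change of x compensates the shift of z by c y, so that xy - p(z) keeps its value on
  the whole ambient space. The number c may later depend on y, which a shear leaves fixed.\<close>

definition shear :: "complex poly \<Rightarrow> complex \<Rightarrow> complex ^ 3 \<Rightarrow> complex ^ 3" where
  "shear p c q = vector [q $ 1 + c * diff_quot p (q $ 3) (c * q $ 2), q $ 2, q $ 3 + c * q $ 2]"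

lemma shear_nth [simp]:
  "shear p c q $ 1 = q $ 1 + c * diff_quot p (q $ 3) (c * q $ 2)"
  "shear p c q $ 2 = q $ 2"
  "shear p c q $ 3 = q $ 3 + c * q $ 2"
  by (simp_all add: shear_def)

lemma shear_add: "shear p s (shear p t q) = shear p (s + t) q"
  using diff_quot_add[of t p "q $ 3" "q $ 2" s]
  by (intro vec3_eqI) (simp_all add: algebra_simps)

lemma shear_0 [simp]: "shear p 0 q = q"
  by (rule vec3_eqI) simp_all

lemma shear_danielewski: "q \<in> danielewski p \<Longrightarrow> shear p c q \<in> danielewski p"
  by (simp add: danielewski_def diff_quot algebra_simps)

lemma shear_polynomial:
  assumes "f \<in> poly_funs B" "\<And>i. (\<lambda>r. g r $ i) \<in> poly_funs B"
  shows "(\<lambda>r. shear p (f r) (g r) $ i) \<in> poly_funs B"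
proof -
  have "\<forall>i. (\<lambda>r. shear p (f r) (g r) $ i) \<in> poly_funs B"
    unfolding forall_3 shear_nth by (intro conjI poly_funs_intros diff_quot_poly_fun assms)
  then show ?thesis by blast
qed

definition flow1 :: "complex poly \<Rightarrow> complex \<Rightarrow> complex ^ 3 \<Rightarrow> complex ^ 3" where
  "flow1 p t q = shear p t q"

definition flow3 :: "complex poly \<Rightarrow> complex \<Rightarrow> complex ^ 3 \<Rightarrow> complex ^ 3" where
  "flow3 p t q = shear p (t * q $ 2) q"

definition swap :: "complex ^ 3 \<Rightarrow> complex ^ 3" where
  "swap q = vector [q $ 2, q $ 1, q $ 3]"

lemma swap_nth [simp]: "swap q $ 1 = q $ 2" "swap q $ 2 = q $ 1" "swap q $ 3 = q $ 3"
  by (simp_all add: swap_def)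

lemma swap_swap [simp]: "swap (swap q) = q"
  by (rule vec3_eqI) simp_all

lemma swap_danielewski [simp]: "swap q \<in> danielewski p \<longleftrightarrow> q \<in> danielewski p"
  by (simp add: danielewski_def mult.commute)

lemma swap_polynomial:
  assumes "\<And>i. (\<lambda>r. g r $ i) \<in> poly_funs B"
  shows "(\<lambda>r. swap (g r) $ i) \<in> poly_funs B"
proof -
  have "\<forall>i. (\<lambda>r. swap (g r) $ i) \<in> poly_funs B"
    by (simp add: forall_3 assms)
  then show ?thesis by blast
qed

lemma poly_funs_swap: "F \<in> poly_funs affine_coords \<Longrightarrow> (\<lambda>q. F (swap q)) \<in> poly_funs affine_coords"
  by (rule poly_funs_affine_subst) (auto intro: swap_polynomial poly_funs_nth)

definition swapped :: "(complex \<Rightarrow> complex ^ 3 \<Rightarrow> complex ^ 3) \<Rightarrow> complex \<Rightarrow> complex ^ 3 \<Rightarrow> complex ^ 3" where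
  "swapped E t q = swap (E t (swap q))"

lemma lie_deriv_swapped: "lie_deriv (swapped E) F q = lie_deriv E (\<lambda>q. F (swap q)) (swap q)"
  by (simp add: lie_deriv_def swapped_def)

lemma polynomial_flow_flow1: "polynomial_flow (danielewski p) (flow1 p)"
  by unfold_locales
    (auto simp: flow1_def shear_add shear_danielewski intro!: shear_polynomial poly_funs_fst poly_funs_snd)

lemma polynomial_flow_flow3: "polynomial_flow (danielewski p) (flow3 p)"
  by unfold_locales
    (auto simp: flow3_def shear_add shear_danielewski distrib_right
      intro!: shear_polynomial poly_funs_fst poly_funs_snd poly_funs.mult)

lemma polynomial_flow_swapped:
  assumes "polynomial_flow (danielewski p) E"
  shows "polynomial_flow (danielewski p) (swapped E)"
proof -
  interpret polynomial_flow "danielewski p" E by fact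
  show ?thesis
  proof
    fix i
    have "(\<lambda>r. (\<lambda>r. swap (E (fst r) (snd r)) $ i) (fst r, swap (snd r))) \<in> poly_funs time_coords"
      by (rule poly_funs_subst[OF swap_polynomial[OF polynomial]])
        (use poly_funs_fst swap_polynomial[OF poly_funs_snd] in \<open>force simp: time_coords_def\<close>)
    then show "(\<lambda>r. swapped E (fst r) (snd r) $ i) \<in> poly_funs time_coords"
      by (simp add: swapped_def)
  qed (auto simp: swapped_def flow_add flow_0 flow_closed)
qed

text \<open>The factor a serves both flows: a = 1 gives \<open>flow1\<close> and a = y gives
  \<open>flow3\<close>.\<close>

lemma shear_velocity:
  assumes F: "F \<in> poly_funs affine_coords"
  shows "((\<lambda>t. F (shear p (t * a) q)) has_field_derivative a * field1 p F q) (at 0)"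
proof -
  define v :: "3 \<Rightarrow> complex" where "v i = a * vector [poly (pderiv p) (q $ 3), 0, q $ 2] $ i" for i
  have v: "v 1 = a * poly (pderiv p) (q $ 3)" "v 2 = 0" "v 3 = a * q $ 2"
    by (simp_all add: v_def)
  obtain d where "((\<lambda>h. diff_quot p (q $ 3) h) has_field_derivative d) (at 0)"
    using diff_quot_differentiable(1)[unfolded field_differentiable_def] by blast
  then have d: "((\<lambda>h. diff_quot p (q $ 3) h) has_field_derivative d) (at (0 * a * q $ 2))"
    by simp
  have "((\<lambda>t. diff_quot p (q $ 3) (t * a * q $ 2)) has_field_derivative d * (a * q $ 2)) (at 0)"
  proof (rule DERIV_chain'[of "\<lambda>t. t * a * q $ 2" _ _ _ "diff_quot p (q $ 3)"])
    show "((\<lambda>t. t * a * q $ 2) has_field_derivative a * q $ 2) (at 0)"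
      by (auto intro!: derivative_eq_intros)
  qed (rule d)
  then have "((\<lambda>t. shear p (t * a) q $ 1) has_field_derivative v 1) (at 0)"
    unfolding shear_nth v by (auto intro!: derivative_eq_intros simp: diff_quot_0)
  moreover have "((\<lambda>t. shear p (t * a) q $ 2) has_field_derivative v 2) (at 0)"
    "((\<lambda>t. shear p (t * a) q $ 3) has_field_derivative v 3) (at 0)"
    unfolding shear_nth v by (auto intro!: derivative_eq_intros)
  ultimately have "\<forall>i. ((\<lambda>t. shear p (t * a) q $ i) has_field_derivative v i) (at 0)"
    by (simp add: forall_3)
  then show ?thesis
    using poly_fun_chain[OF F, of "\<lambda>t. shear p (t * a) q" v]
    by (simp add: sum_3 v field1_def algebra_simps)
qed

lemma lie_deriv_flow1: "F \<in> poly_funs affine_coords \<Longrightarrow> lie_deriv (flow1 p) F q = field1 p F q"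
  using shear_velocity[of F p 1 q] by (simp add: lie_deriv_def flow1_def DERIV_imp_deriv)

lemma lie_deriv_flow3:
  "F \<in> poly_funs affine_coords \<Longrightarrow> lie_deriv (flow3 p) F q = q $ 2 * field1 p F q"
  using shear_velocity[of F p "q $ 2" q] by (simp add: lie_deriv_def flow3_def DERIV_imp_deriv)

lemma partial_deriv_swap:
  "partial_deriv 1 (\<lambda>q. F (swap q)) (swap q) = partial_deriv 2 F q"
  "partial_deriv 2 (\<lambda>q. F (swap q)) (swap q) = partial_deriv 1 F q"
  "partial_deriv 3 (\<lambda>q. F (swap q)) (swap q) = partial_deriv 3 F q"
proof -
  have "swap (\<chi> j. if j = 1 then s else swap q $ j) = (\<chi> j. if j = 2 then s else q $ j)"
    "swap (\<chi> j. if j = 2 then s else swap q $ j) = (\<chi> j. if j = 1 then s else q $ j)"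
    "swap (\<chi> j. if j = 3 then s else swap q $ j) = (\<chi> j. if j = 3 then s else q $ j)" for s
    by (intro vec3_eqI; simp)+
  then show "partial_deriv 1 (\<lambda>q. F (swap q)) (swap q) = partial_deriv 2 F q"
    "partial_deriv 2 (\<lambda>q. F (swap q)) (swap q) = partial_deriv 1 F q"
    "partial_deriv 3 (\<lambda>q. F (swap q)) (swap q) = partial_deriv 3 F q"
    by (simp_all add: partial_deriv_def)
qed

lemma field1_swap: "field1 p (\<lambda>q. F (swap q)) (swap q) = field2 p F q"
  by (simp add: field1_def field2_def partial_deriv_swap)

text \<open>This supplies the assumption under which the four operators inherit local nilpotency and
  their flows from the locale; \<open>D2\<close> and \<open>D4\<close> are reached by transport
  along \<open>swap\<close>.\<close>

lemma generator_restrict: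
  assumes "F \<in> poly_funs affine_coords"
  shows "D1 p (restrict F (danielewski p)) = restrict (lie_deriv (flow1 p) F) (danielewski p)"
    "D2 p (restrict F (danielewski p)) = restrict (lie_deriv (swapped (flow1 p)) F) (danielewski p)"
    "D3 p (restrict F (danielewski p)) = restrict (lie_deriv (flow3 p) F) (danielewski p)"
    "D4 p (restrict F (danielewski p)) = restrict (lie_deriv (swapped (flow3 p)) F) (danielewski p)"
  using assms poly_funs_swap[OF assms]
  by (auto simp: D1_restrict D2_restrict D3_def D4_def lie_deriv_flow1 lie_deriv_flow3
      lie_deriv_swapped field1_swap intro!: restrict_ext)

abbreviation danielewski_group :: "complex poly \<Rightarrow> (complex ^ 3 \<Rightarrow> complex ^ 3) monoid" where
  "danielewski_group p \<equiv> flow_group (danielewski p) {D1 p, D2 p, D3 p, D4 p}"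

lemma danielewski_locally_nilpotent:
  "\<forall>D \<in> {D1 p, D2 p, D3 p, D4 p}. locally_nilpotent_derivation (danielewski p) D"
  using polynomial_flow.generator_locally_nilpotent[OF polynomial_flow_flow1[of p], of "D1 p"]
    polynomial_flow.generator_locally_nilpotent[OF polynomial_flow_flow3[of p], of "D3 p"]
    polynomial_flow.generator_locally_nilpotent[OF polynomial_flow_swapped[OF polynomial_flow_flow1[of p]], of "D2 p"]
    polynomial_flow.generator_locally_nilpotent[OF polynomial_flow_swapped[OF polynomial_flow_flow3[of p]], of "D4 p"]
  by (auto simp: generator_restrict)

lemma flows_in_danielewski_group:
  "restrict (flow1 p t) (danielewski p) \<in> carrier (danielewski_group p)"
  "restrict (flow3 p t) (danielewski p) \<in> carrier (danielewski_group p)"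
  "restrict (swapped (flow1 p) t) (danielewski p) \<in> carrier (danielewski_group p)"
  using polynomial_flow.generator_flow[OF polynomial_flow_flow1[of p], of "D1 p" t]
    polynomial_flow.generator_flow[OF polynomial_flow_flow3[of p], of "D3 p" t]
    polynomial_flow.generator_flow[OF polynomial_flow_swapped[OF polynomial_flow_flow1[of p]], of "D2 p" t]
  by (auto simp: generator_restrict intro: flow_in_flow_group)


section \<open>The Poisson bracket\<close>

lemma partial_deriv_shifted:
  assumes "F \<in> poly_funs affine_coords"
  shows "((\<lambda>t. F (\<chi> j. if j = i then q $ i + t else q $ j)) has_field_derivative partial_deriv i F q) (at 0)"
proof -
  have "((\<lambda>s. F (\<chi> j. if j = i then s else q $ j)) has_field_derivative partial_deriv i F q)
      (at (0 + q $ i))"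
    using poly_fun_partial[OF assms, of i q] by simp
  then show ?thesis
    by (simp only: DERIV_shift add.commute)
qed

lemma partial_deriv_add:
  assumes "F \<in> poly_funs affine_coords" "G \<in> poly_funs affine_coords"
  shows "partial_deriv i (\<lambda>q. F q + G q) q = partial_deriv i F q + partial_deriv i G q"
  unfolding partial_deriv_def[of i "\<lambda>q. F q + G q"]
  by (rule DERIV_imp_deriv) (intro DERIV_add poly_fun_partial assms)

lemma partial_deriv_cmult:
  assumes "F \<in> poly_funs affine_coords"
  shows "partial_deriv i (\<lambda>q. c * F q) q = c * partial_deriv i F q"
  unfolding partial_deriv_def[of i "\<lambda>q. c * F q"]
  by (rule DERIV_imp_deriv) (intro DERIV_cmult poly_fun_partial assms)

lemma partial_deriv_nth: "partial_deriv i (\<lambda>q. q $ j) q = (if i = j then 1 else 0)"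
  by (auto simp: partial_deriv_def)

lemma partial_deriv_chain:
  fixes g :: "complex ^ 'n \<Rightarrow> complex ^ 'm"
  assumes F: "F \<in> poly_funs affine_coords" and g: "\<And>j. (\<lambda>q. g q $ j) \<in> poly_funs affine_coords"
  shows "partial_deriv i (\<lambda>q. F (g q)) q =
    (\<Sum>j\<in>UNIV. partial_deriv i (\<lambda>q. g q $ j) q * partial_deriv j F (g q))"
proof -
  let ?c = "\<lambda>t. \<chi> j. if j = i then q $ i + t else q $ j"
  have 0: "?c 0 = q"
    by (simp add: vec_eq_iff)
  have "((\<lambda>t. F (g (?c t))) has_field_derivative
      (\<Sum>j\<in>UNIV. partial_deriv i (\<lambda>q. g q $ j) q * partial_deriv j F (g (?c 0)))) (at 0)"
    by (rule poly_fun_chain[OF F]) (rule partial_deriv_shifted[OF g])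
  moreover have "((\<lambda>t. F (g (?c t))) has_field_derivative partial_deriv i (\<lambda>q. F (g q)) q) (at 0)"
    by (rule partial_deriv_shifted[OF poly_funs_affine_subst[OF F g]])
  ultimately show ?thesis
    unfolding 0 by (rule DERIV_unique[symmetric])
qed

text \<open>
  The Poisson bracket given by the cross product of gradients with the gradient of \<open>x y - p(z)\<close>. It
  makes \<open>D\<^sub>1\<close> and \<open>D\<^sub>3\<close> the Hamiltonian fields of \<open>y\<close> and \<open>y\<^sup>2/2\<close>, and \<open>D\<^sub>2\<close> and \<open>D\<^sub>4\<close> those of
  \<open>-x\<close> and \<open>-x\<^sup>2/2\<close>.
\<close>

definition bracket ::
    "complex poly \<Rightarrow> (complex ^ 3 \<Rightarrow> complex) \<Rightarrow> (complex ^ 3 \<Rightarrow> complex) \<Rightarrow> complex ^ 3 \<Rightarrow> complex" where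
  "bracket p F H q =
     poly (pderiv p) (q $ 3) *
       (partial_deriv 2 F q * partial_deriv 1 H q - partial_deriv 1 F q * partial_deriv 2 H q) +
     q $ 1 * (partial_deriv 3 F q * partial_deriv 1 H q - partial_deriv 1 F q * partial_deriv 3 H q) +
     q $ 2 * (partial_deriv 2 F q * partial_deriv 3 H q - partial_deriv 3 F q * partial_deriv 2 H q)"

lemma bracket_add:
  assumes "F \<in> poly_funs affine_coords" "G \<in> poly_funs affine_coords"
  shows "bracket p (\<lambda>q. F q + G q) H q = bracket p F H q + bracket p G H q"
  by (simp add: bracket_def partial_deriv_add[OF assms] algebra_simps)

lemma bracket_cmult:
  assumes "F \<in> poly_funs affine_coords"
  shows "bracket p (\<lambda>q. c * F q) H q = c * bracket p F H q"
  by (simp add: bracket_def partial_deriv_cmult[OF assms] algebra_simps)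

lemma bracket_nth_expand:
  "bracket p F H q = (\<Sum>j\<in>UNIV. bracket p F (\<lambda>q. q $ j) q * partial_deriv j H q)"
  by (simp add: bracket_def partial_deriv_nth sum_3 algebra_simps)

lemma bracket_y: "bracket p (\<lambda>q. q $ 2) H q = field1 p H q"
  by (simp add: bracket_def partial_deriv_nth field1_def)

section \<open>Maps preserving the bracket up to a constant factor\<close>

definition poisson_map :: "complex poly \<Rightarrow> complex \<Rightarrow> (complex ^ 3 \<Rightarrow> complex ^ 3) \<Rightarrow> bool" where
  "poisson_map p \<epsilon> g \<longleftrightarrow> (\<forall>i. (\<lambda>q. g q $ i) \<in> poly_funs affine_coords) \<and>
     (\<forall>F \<in> poly_funs affine_coords. \<forall>H \<in> poly_funs affine_coords. \<forall>q.
        bracket p (\<lambda>q. F (g q)) (\<lambda>q. H (g q)) q = \<epsilon> * bracket p F H (g q))"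

lemma poisson_mapD:
  assumes "poisson_map p \<epsilon> g" "F \<in> poly_funs affine_coords" "H \<in> poly_funs affine_coords"
  shows "bracket p (\<lambda>q. F (g q)) (\<lambda>q. H (g q)) q = \<epsilon> * bracket p F H (g q)"
  using assms unfolding poisson_map_def by blast

text \<open>By the chain rule the bracket of two pullbacks is a combination of the brackets of the
  coordinates of g, weighted by the 2 x 2 minors of the gradients of F and H. So three pairs of
  coordinates suffice.\<close>

lemma poisson_mapI:
  assumes g: "\<And>i. (\<lambda>q. g q $ i) \<in> poly_funs affine_coords"
    and B: "\<And>q. bracket p (\<lambda>q. g q $ 1) (\<lambda>q. g q $ 2) q = - \<epsilon> * poly (pderiv p) (g q $ 3)"
      "\<And>q. bracket p (\<lambda>q. g q $ 1) (\<lambda>q. g q $ 3) q = - \<epsilon> * g q $ 1"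
      "\<And>q. bracket p (\<lambda>q. g q $ 2) (\<lambda>q. g q $ 3) q = \<epsilon> * g q $ 2"
  shows "poisson_map p \<epsilon> g"
  unfolding poisson_map_def
proof (intro conjI allI ballI g)
  fix F H :: "complex ^ 3 \<Rightarrow> complex" and q
  assume F: "F \<in> poly_funs affine_coords" and H: "H \<in> poly_funs affine_coords"
  define f where "f i = partial_deriv i F (g q)" for i
  define h where "h i = partial_deriv i H (g q)" for i
  have "bracket p (\<lambda>q. F (g q)) (\<lambda>q. H (g q)) q =
      (f 1 * h 2 - f 2 * h 1) * bracket p (\<lambda>q. g q $ 1) (\<lambda>q. g q $ 2) q +
      (f 1 * h 3 - f 3 * h 1) * bracket p (\<lambda>q. g q $ 1) (\<lambda>q. g q $ 3) q +
      (f 2 * h 3 - f 3 * h 2) * bracket p (\<lambda>q. g q $ 2) (\<lambda>q. g q $ 3) q"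
    unfolding bracket_def partial_deriv_chain[OF F g] partial_deriv_chain[OF H g] sum_3
      f_def[symmetric] h_def[symmetric]
    by algebra
  also have "\<dots> = \<epsilon> * bracket p F H (g q)"
    unfolding B bracket_def[of p F H] f_def[symmetric] h_def[symmetric] by algebra
  finally show "bracket p (\<lambda>q. F (g q)) (\<lambda>q. H (g q)) q = \<epsilon> * bracket p F H (g q)" .
qed

lemma poisson_map_compose:
  assumes "poisson_map p \<epsilon> g" "poisson_map p \<delta> k"
  shows "poisson_map p (\<epsilon> * \<delta>) (\<lambda>q. g (k q))"
proof -
  have g: "(\<lambda>q. g q $ i) \<in> poly_funs affine_coords" and k: "(\<lambda>q. k q $ i) \<in> poly_funs affine_coords" for i
    using assms by (auto simp: poisson_map_def)
  have "(\<lambda>q. g (k q) $ i) \<in> poly_funs affine_coords" for i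
    by (rule poly_funs_affine_subst[OF g k])
  moreover have "bracket p (\<lambda>q. F (g (k q))) (\<lambda>q. H (g (k q))) q = \<epsilon> * \<delta> * bracket p F H (g (k q))"
    if F: "F \<in> poly_funs affine_coords" and H: "H \<in> poly_funs affine_coords" for F H q
    using poisson_mapD[OF assms(2) poly_funs_affine_subst[OF F g] poly_funs_affine_subst[OF H g]]
      poisson_mapD[OF assms(1) F H]
    by (simp add: mult.left_commute)
  ultimately show ?thesis
    by (simp add: poisson_map_def)
qed

lemma poisson_map_swap: "poisson_map p (- 1) swap"
  by (rule poisson_mapI)
    (auto simp: bracket_def partial_deriv_nth intro: swap_polynomial poly_funs_nth)

text \<open>A polynomial C in y treats both flows at once: C is constant for \<open>flow1\<close>
  and C = t y for \<open>flow3\<close>.\<close>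

lemma poisson_map_shear: "poisson_map p 1 (\<lambda>q. shear p (poly C (q $ 2)) q)"
proof (rule poisson_mapI)
  fix i show "(\<lambda>q. shear p (poly C (q $ 2)) q $ i) \<in> poly_funs affine_coords"
    by (intro shear_polynomial poly_funs_intros)
next
  fix q :: "complex ^ 3"
  define x y z c c' h b where "x = q $ 1" and "y = q $ 2" and "z = q $ 3"
    and "c = poly C y" and "c' = poly (pderiv C) y" and "h = c * y" and "b = c' * y + c"
  define R where "R = diff_quot p z h"
  obtain R1 where R1: "((\<lambda>z. diff_quot p z h) has_field_derivative R1) (at z)"
    using diff_quot_differentiable(2)[unfolded field_differentiable_def] by blast
  obtain R2 where R2: "((\<lambda>h. diff_quot p z h) has_field_derivative R2) (at h)"
    using diff_quot_differentiable(1)[unfolded field_differentiable_def] by blast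
  \<comment> \<open>Differentiating p(z + h) = p(z) + h R in z and in h gives two expressions for
    p'(z + h), which tie together the partial derivatives R1 and R2 of the quotient.\<close>
  have "((\<lambda>z. poly p z + h * diff_quot p z h) has_field_derivative poly (pderiv p) z + h * R1) (at z)"
    by (rule derivative_eq_intros R1 | simp)+
  moreover have "((\<lambda>z. poly p (z + h)) has_field_derivative poly (pderiv p) (z + h)) (at z)"
    by (auto intro!: derivative_eq_intros DERIV_chain'[OF _ poly_DERIV])
  ultimately have eq1: "poly (pderiv p) (z + h) = poly (pderiv p) z + h * R1"
    unfolding diff_quot by (blast intro: DERIV_unique)
  have "((\<lambda>h. poly p z + h * diff_quot p z h) has_field_derivative R + h * R2) (at h)"
    unfolding R_def by (rule derivative_eq_intros R2 | simp)+
  moreover have "((\<lambda>h. poly p (z + h)) has_field_derivative poly (pderiv p) (z + h)) (at h)"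
    by (auto intro!: derivative_eq_intros DERIV_chain'[OF _ poly_DERIV])
  ultimately have eq2: "poly (pderiv p) (z + h) = R + h * R2"
    unfolding diff_quot by (blast intro: DERIV_unique)
  let ?g = "\<lambda>q. shear p (poly C (q $ 2)) q"
  have h': "((\<lambda>s. poly C s * s) has_field_derivative b) (at y)"
    by (auto intro!: derivative_eq_intros simp: b_def c_def c'_def)
  have "((\<lambda>s. diff_quot p z (poly C s * s)) has_field_derivative R2 * b) (at y)"
    by (rule DERIV_chain'[OF h', of "diff_quot p z"]) (use R2 in \<open>simp add: h_def c_def\<close>)
  then have "((\<lambda>s. x + poly C s * diff_quot p z (poly C s * s)) has_field_derivative
      c' * R + c * (R2 * b)) (at y)"
    by (auto intro!: derivative_eq_intros simp: R_def h_def c_def c'_def)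
  then have d21: "partial_deriv 2 (\<lambda>q. ?g q $ 1) q = c' * R + c * (R2 * b)"
    by (simp add: partial_deriv_def x_def y_def z_def DERIV_imp_deriv)
  have "((\<lambda>s. x + c * diff_quot p s h) has_field_derivative c * R1) (at z)"
    by (rule derivative_eq_intros R1 | simp)+
  then have d31: "partial_deriv 3 (\<lambda>q. ?g q $ 1) q = c * R1"
    by (simp add: partial_deriv_def x_def y_def z_def c_def h_def DERIV_imp_deriv)
  have "((\<lambda>s. s + c * diff_quot p z h) has_field_derivative 1) (at x)"
    by (auto intro!: derivative_eq_intros)
  then have d11: "partial_deriv 1 (\<lambda>q. ?g q $ 1) q = 1"
    by (simp add: partial_deriv_def x_def y_def z_def c_def h_def DERIV_imp_deriv)
  have "((\<lambda>s. z + poly C s * s) has_field_derivative b) (at y)"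
    using DERIV_add[OF DERIV_const[of z] h'] by simp
  then have d23: "partial_deriv 2 (\<lambda>q. ?g q $ 3) q = b"
    by (simp add: partial_deriv_def x_def y_def z_def DERIV_imp_deriv)
  have d13: "partial_deriv 1 (\<lambda>q. ?g q $ 3) q = 0"
    by (simp add: partial_deriv_def)
  have "((\<lambda>s. s + c * y) has_field_derivative 1) (at z)"
    by (auto intro!: derivative_eq_intros)
  then have d33: "partial_deriv 3 (\<lambda>q. ?g q $ 3) q = 1"
    by (simp add: partial_deriv_def x_def y_def z_def c_def DERIV_imp_deriv)
  note ds = d11 d21 d31 d13 d23 d33
  have q: "q $ 1 = x" "q $ 2 = y" "q $ 3 = z"
    by (simp_all add: x_def y_def z_def)
  have g2: "(\<lambda>q. ?g q $ 2) = (\<lambda>q. q $ 2)" and g3: "?g q $ 3 = z + h" and g1: "?g q $ 1 = x + c * R"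
    by (simp_all add: q c_def h_def R_def)
  show "bracket p (\<lambda>q. ?g q $ 1) (\<lambda>q. ?g q $ 2) q = - 1 * poly (pderiv p) (?g q $ 3)"
    unfolding g2 g3 unfolding bracket_def ds q partial_deriv_nth eq1 by (simp add: h_def)
  show "bracket p (\<lambda>q. ?g q $ 2) (\<lambda>q. ?g q $ 3) q = 1 * ?g q $ 2"
    unfolding g2 bracket_def ds q partial_deriv_nth by (simp add: q)
  \<comment> \<open>The two sides of the last bracket relation differ by b times this
    identity.\<close>
  have "R + h * R2 = poly (pderiv p) z + h * R1"
    using eq1 eq2 by simp
  then show "bracket p (\<lambda>q. ?g q $ 1) (\<lambda>q. ?g q $ 3) q = - 1 * ?g q $ 1"
    unfolding g1 unfolding bracket_def ds q h_def b_def by algebra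
qed

lemma poisson_map_flow1: "poisson_map p 1 (flow1 p t)"
  using poisson_map_shear[of p "[:t:]"] by (simp add: flow1_def[abs_def])

lemma poisson_map_flow3: "poisson_map p 1 (flow3 p t)"
  using poisson_map_shear[of p "[:0, t:]"] by (simp add: flow3_def[abs_def] mult.commute)

text \<open>The sign of \<open>swap\<close> enters twice and cancels.\<close>

lemma poisson_map_flow2: "poisson_map p 1 (swapped (flow1 p) t)"
  using poisson_map_compose[OF poisson_map_swap poisson_map_compose[OF poisson_map_flow1 poisson_map_swap]]
  by (simp add: swapped_def[abs_def])


section \<open>Hamiltonians integrated by the group\<close>

text \<open>Chain rule along the diagonal: the derivative is the sum of those with one argument
  frozen at time 0. The induction only yields that a and b exist; they are identified later by
  uniqueness of derivatives.\<close>

lemma poly_funs_time_diagonal: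
  fixes c :: "complex \<Rightarrow> complex ^ 'n"
  assumes "f \<in> poly_funs time_coords"
    and "\<And>i. ((\<lambda>s. c s $ i) has_field_derivative v i) (at 0)"
  shows "\<exists>a b. ((\<lambda>s. f (0, c s)) has_field_derivative a) (at 0) \<and>
     ((\<lambda>s. f (s, c 0)) has_field_derivative b) (at 0) \<and>
     ((\<lambda>s. f (s, c s)) has_field_derivative a + b) (at 0)"
  using assms(1)
proof induction
  case (coord f)
  then consider "f = fst" | i where "f = (\<lambda>r. snd r $ i)"
    by (auto simp: time_coords_def)
  then show ?case
  proof cases
    case 1
    then show ?thesis by (intro exI[of _ 0] exI[of _ 1]) auto
  next
    case (2 i)
    then show ?thesis using assms(2)[of i] by (intro exI[of _ "v i"] exI[of _ 0]) auto
  qed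
next
  case (const a)
  show ?case by (intro exI[of _ 0]) auto
next
  case (add f g)
  then obtain a b a' b' where
    "((\<lambda>s. f (0, c s)) has_field_derivative a) (at 0)" "((\<lambda>s. g (0, c s)) has_field_derivative a') (at 0)"
    "((\<lambda>s. f (s, c 0)) has_field_derivative b) (at 0)" "((\<lambda>s. g (s, c 0)) has_field_derivative b') (at 0)"
    "((\<lambda>s. f (s, c s)) has_field_derivative a + b) (at 0)"
    "((\<lambda>s. g (s, c s)) has_field_derivative a' + b') (at 0)"
    by blast
  then show ?case
    by (intro exI[of _ "a + a'"] exI[of _ "b + b'"]) (auto intro!: derivative_eq_intros)
next
  case (mult f g)
  then obtain a b a' b' where
    "((\<lambda>s. f (0, c s)) has_field_derivative a) (at 0)" "((\<lambda>s. g (0, c s)) has_field_derivative a') (at 0)"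
    "((\<lambda>s. f (s, c 0)) has_field_derivative b) (at 0)" "((\<lambda>s. g (s, c 0)) has_field_derivative b') (at 0)"
    "((\<lambda>s. f (s, c s)) has_field_derivative a + b) (at 0)"
    "((\<lambda>s. g (s, c s)) has_field_derivative a' + b') (at 0)"
    by blast
  then show ?case
    by (intro exI[of _ "a * g (0, c 0) + a' * f (0, c 0)"] exI[of _ "b * g (0, c 0) + b' * f (0, c 0)"])
      (auto intro!: derivative_eq_intros simp: algebra_simps)
qed

text \<open>No group law in s is asked, since it would be lost under sums. Polynomiality and
  velocity refer to the ambient space; only membership in the group refers to the surface.\<close>

definition integrates ::
    "complex poly \<Rightarrow> (complex \<Rightarrow> complex ^ 3 \<Rightarrow> complex ^ 3) \<Rightarrow> (complex ^ 3 \<Rightarrow> complex) \<Rightarrow> bool" where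
  "integrates p \<theta> H \<longleftrightarrow>
     (\<forall>i. (\<lambda>r. \<theta> (fst r) (snd r) $ i) \<in> poly_funs time_coords) \<and>
     (\<forall>s. restrict (\<theta> s) (danielewski p) \<in> carrier (danielewski_group p)) \<and>
     (\<forall>q. \<theta> 0 q = q) \<and>
     (\<forall>q i. ((\<lambda>s. \<theta> s q $ i) has_field_derivative bracket p H (\<lambda>q. q $ i) q) (at 0))"

lemma integratesD:
  assumes "integrates p \<theta> H"
  shows "(\<lambda>r. \<theta> (fst r) (snd r) $ i) \<in> poly_funs time_coords"
    "restrict (\<theta> s) (danielewski p) \<in> carrier (danielewski_group p)"
    "\<theta> 0 q = q"
    "((\<lambda>s. \<theta> s q $ i) has_field_derivative bracket p H (\<lambda>q. q $ i) q) (at 0)"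
  using assms unfolding integrates_def by blast+

definition hamiltonians :: "complex poly \<Rightarrow> (complex ^ 3 \<Rightarrow> complex) set" where
  "hamiltonians p = {H \<in> poly_funs affine_coords. \<exists>\<theta>. integrates p \<theta> H}"

lemma hamiltonians_y: "(\<lambda>q. q $ 2) \<in> hamiltonians p"
proof -
  interpret polynomial_flow "danielewski p" "flow1 p" by (rule polynomial_flow_flow1)
  have "integrates p (flow1 p) (\<lambda>q. q $ 2)"
    unfolding integrates_def bracket_y
  proof (intro conjI allI polynomial flow_0 flows_in_danielewski_group)
    fix q i
    show "((\<lambda>s. flow1 p s q $ i) has_field_derivative field1 p (\<lambda>q. q $ i) q) (at 0)"
      using has_lie_deriv[OF poly_funs_nth[of i], of q] by (simp add: lie_deriv_flow1 poly_funs_nth)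
  qed
  then show ?thesis
    by (auto simp: hamiltonians_def poly_funs_nth)
qed

text \<open>Both families start at the identity, so the velocity of their composition at time 0 is
  the sum of the velocities.\<close>

lemma hamiltonians_add:
  assumes "H \<in> hamiltonians p" "K \<in> hamiltonians p"
  shows "(\<lambda>q. H q + K q) \<in> hamiltonians p"
proof -
  obtain \<theta> \<eta> where \<theta>: "integrates p \<theta> H" and \<eta>: "integrates p \<eta> K"
    and HK: "H \<in> poly_funs affine_coords" "K \<in> poly_funs affine_coords"
    using assms by (auto simp: hamiltonians_def)
  have "integrates p (\<lambda>s q. \<theta> s (\<eta> s q)) (\<lambda>q. H q + K q)"
    unfolding integrates_def
  proof (intro conjI allI)
    fix i
    have "(\<lambda>r. (\<lambda>r. \<theta> (fst r) (snd r) $ i) (fst r, \<eta> (fst r) (snd r))) \<in> poly_funs time_coords"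
    proof (rule poly_funs_subst[of "\<lambda>r. \<theta> (fst r) (snd r) $ i" time_coords "\<lambda>r. (fst r, \<eta> (fst r) (snd r))"])
      show "(\<lambda>r. \<theta> (fst r) (snd r) $ i) \<in> poly_funs time_coords"
        by (rule integratesD(1)[OF \<theta>])
      fix b :: "complex \<times> (complex ^ 3) \<Rightarrow> complex" assume "b \<in> time_coords"
      then show "(\<lambda>q. b (fst q, \<eta> (fst q) (snd q))) \<in> poly_funs time_coords"
        using integratesD(1)[OF \<eta>] poly_funs_fst by (auto simp: time_coords_def)
    qed
    then show "(\<lambda>r. \<theta> (fst r) (\<eta> (fst r) (snd r)) $ i) \<in> poly_funs time_coords"
      by simp
  next
    fix s show "restrict (\<lambda>q. \<theta> s (\<eta> s q)) (danielewski p) \<in> carrier (danielewski_group p)"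
      by (rule flow_group_restrict_compose[OF integratesD(2)[OF \<theta>] integratesD(2)[OF \<eta>]])
  next
    fix q show "\<theta> 0 (\<eta> 0 q) = q"
      by (simp add: integratesD(3)[OF \<theta>] integratesD(3)[OF \<eta>])
  next
    fix q i
    let ?f = "\<lambda>r. \<theta> (fst r) (snd r) $ i"
    obtain a b where ab: "((\<lambda>s. ?f (0, \<eta> s q)) has_field_derivative a) (at 0)"
        "((\<lambda>s. ?f (s, \<eta> 0 q)) has_field_derivative b) (at 0)"
        "((\<lambda>s. ?f (s, \<eta> s q)) has_field_derivative a + b) (at 0)"
      using poly_funs_time_diagonal[OF integratesD(1)[OF \<theta>] integratesD(4)[OF \<eta>]] by blast
    have "((\<lambda>s. \<theta> s q $ i) has_field_derivative b) (at 0)"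
      using ab(2) by (simp add: integratesD(3)[OF \<eta>])
    then have "b = bracket p H (\<lambda>q. q $ i) q"
      by (rule DERIV_unique[OF _ integratesD(4)[OF \<theta>]])
    moreover have "((\<lambda>s. \<eta> s q $ i) has_field_derivative a) (at 0)"
      using ab(1) by (simp add: integratesD(3)[OF \<theta>])
    then have "a = bracket p K (\<lambda>q. q $ i) q"
      by (rule DERIV_unique[OF _ integratesD(4)[OF \<eta>]])
    ultimately show "((\<lambda>s. \<theta> s (\<eta> s q) $ i) has_field_derivative
        bracket p (\<lambda>q. H q + K q) (\<lambda>q. q $ i) q) (at 0)"
      using ab(3) by (simp add: bracket_add[OF HK] add.commute)
  qed
  then show ?thesis
    using HK by (auto simp: hamiltonians_def intro: poly_funs.add)
qed

lemma hamiltonians_cmult: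
  assumes "H \<in> hamiltonians p"
  shows "(\<lambda>q. c * H q) \<in> hamiltonians p"
proof -
  obtain \<theta> where \<theta>: "integrates p \<theta> H" and H: "H \<in> poly_funs affine_coords"
    using assms by (auto simp: hamiltonians_def)
  have "integrates p (\<lambda>s. \<theta> (c * s)) (\<lambda>q. c * H q)"
    unfolding integrates_def
  proof (intro conjI allI)
    fix i
    have "(\<lambda>r. (\<lambda>r. \<theta> (fst r) (snd r) $ i) (c * fst r, snd r)) \<in> poly_funs time_coords"
    proof (rule poly_funs_subst[of "\<lambda>r. \<theta> (fst r) (snd r) $ i" time_coords "\<lambda>r. (c * fst r, snd r)"])
      show "(\<lambda>r. \<theta> (fst r) (snd r) $ i) \<in> poly_funs time_coords"
        by (rule integratesD(1)[OF \<theta>])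
      fix b :: "complex \<times> (complex ^ 3) \<Rightarrow> complex" assume "b \<in> time_coords"
      then show "(\<lambda>q. b (c * fst q, snd q)) \<in> poly_funs time_coords"
        by (elim time_coordsE) (auto intro: poly_funs_intros poly_funs_fst poly_funs_snd)
    qed
    then show "(\<lambda>r. \<theta> (c * fst r) (snd r) $ i) \<in> poly_funs time_coords"
      by simp
  next
    fix q i
    have "((\<lambda>s. \<theta> s q $ i) has_field_derivative bracket p H (\<lambda>q. q $ i) q) (at (c * 0))"
      using integratesD(4)[OF \<theta>] by simp
    from DERIV_chain'[OF DERIV_cmult[OF DERIV_ident] this]
    show "((\<lambda>s. \<theta> (c * s) q $ i) has_field_derivative bracket p (\<lambda>q. c * H q) (\<lambda>q. q $ i) q) (at 0)"
      by (simp add: bracket_cmult[OF H] mult.commute)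
  qed (simp_all add: integratesD(2,3)[OF \<theta>])
  then show ?thesis
    using H by (auto simp: hamiltonians_def intro: poly_funs_intros)
qed

lemma hamiltonians_sum:
  "(\<And>i. i \<in> A \<Longrightarrow> H i \<in> hamiltonians p) \<Longrightarrow> (\<lambda>q. \<Sum>i\<in>A. H i q) \<in> hamiltonians p"
proof (induction A rule: infinite_finite_induct)
  case (insert x F)
  then show ?case by (simp add: hamiltonians_add)
\<comment> \<open>Sums over the empty set or an infinite set are 0, and the zero function is 0 times
  y.\<close>
qed (use hamiltonians_cmult[OF hamiltonians_y, of 0] in auto)

text \<open>Conjugating by a Poisson automorphism transports Hamiltonian fields.\<close>

lemma hamiltonians_conjugate:
  assumes "H \<in> hamiltonians p" and g: "poisson_map p 1 g" and g': "\<And>i. (\<lambda>q. g' q $ i) \<in> poly_funs affine_coords"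
    and inv: "\<And>q. g' (g q) = q"
    and G: "restrict g (danielewski p) \<in> carrier (danielewski_group p)"
      "restrict g' (danielewski p) \<in> carrier (danielewski_group p)"
  shows "(\<lambda>q. H (g q)) \<in> hamiltonians p"
proof -
  obtain \<theta> where \<theta>: "integrates p \<theta> H" and H: "H \<in> poly_funs affine_coords"
    using assms by (auto simp: hamiltonians_def)
  have gp: "(\<lambda>q. g q $ i) \<in> poly_funs affine_coords" for i
    using g by (simp add: poisson_map_def)
  have "integrates p (\<lambda>s q. g' (\<theta> s (g q))) (\<lambda>q. H (g q))"
    unfolding integrates_def
  proof (intro conjI allI)
    fix i
    have "(\<lambda>r. (\<lambda>r. \<theta> (fst r) (snd r) $ j) (fst r, g (snd r))) \<in> poly_funs time_coords" for j
    proof (rule poly_funs_subst[of "\<lambda>r. \<theta> (fst r) (snd r) $ j" time_coords "\<lambda>r. (fst r, g (snd r))"])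
      show "(\<lambda>r. \<theta> (fst r) (snd r) $ j) \<in> poly_funs time_coords"
        by (rule integratesD(1)[OF \<theta>])
      fix b :: "complex \<times> (complex ^ 3) \<Rightarrow> complex" assume "b \<in> time_coords"
      then show "(\<lambda>r. b (fst r, g (snd r))) \<in> poly_funs time_coords"
        using poly_funs_fst poly_funs_affine_subst[OF gp poly_funs_snd] by (auto simp: time_coords_def)
    qed
    then show "(\<lambda>r. g' (\<theta> (fst r) (g (snd r))) $ i) \<in> poly_funs time_coords"
      by (intro poly_funs_affine_subst[OF g']) simp
  next
    fix s show "restrict (\<lambda>q. g' (\<theta> s (g q))) (danielewski p) \<in> carrier (danielewski_group p)"
      by (rule flow_group_restrict_compose[OF G(2) flow_group_restrict_compose[OF integratesD(2)[OF \<theta>] G(1)]])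
  next
    fix q show "g' (\<theta> 0 (g q)) = q"
      by (simp add: integratesD(3)[OF \<theta>] inv)
  next
    fix q i
    let ?F = "\<lambda>q. g' q $ i"
    \<comment> \<open>The i-th velocity of g' o \<open>\<theta> s\<close> o g at q is {H, g'_i} at g
      q. As g preserves the bracket, this is {H o g, g'_i o g} at q, and g'_i o g is the i-th
      coordinate.\<close>
    have "((\<lambda>s. ?F (\<theta> s (g q))) has_field_derivative
        (\<Sum>j\<in>UNIV. bracket p H (\<lambda>q. q $ j) (g q) * partial_deriv j ?F (\<theta> 0 (g q)))) (at 0)"
      by (rule poly_fun_chain[OF g' integratesD(4)[OF \<theta>]])
    also have "(\<Sum>j\<in>UNIV. bracket p H (\<lambda>q. q $ j) (g q) * partial_deriv j ?F (\<theta> 0 (g q))) =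
        bracket p H ?F (g q)"
      using bracket_nth_expand[of p H ?F "g q"] by (simp add: integratesD(3)[OF \<theta>])
    also have "\<dots> = bracket p (\<lambda>q. H (g q)) (\<lambda>q. ?F (g q)) q"
      using poisson_mapD[OF g H g'] by simp
    finally show "((\<lambda>s. g' (\<theta> s (g q)) $ i) has_field_derivative
        bracket p (\<lambda>q. H (g q)) (\<lambda>q. q $ i) q) (at 0)"
      by (simp add: inv)
  qed
  then show ?thesis
    using poly_funs_affine_subst[OF H gp] by (auto simp: hamiltonians_def)
qed

text \<open>
  Replacing \<open>h s\<close> by \<open>h (2 s) - 2\<^sup>N h s\<close> eliminates the coefficient of \<open>s\<^sup>N\<close> from a polynomial \<open>h\<close> of
  degree \<open>N\<close>.
\<close>

lemma coefficients_in_span: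
  fixes c :: "nat \<Rightarrow> 'a \<Rightarrow> complex"
  assumes V: "\<And>f g. f \<in> V \<Longrightarrow> g \<in> V \<Longrightarrow> (\<lambda>q. f q + g q) \<in> V" "\<And>f a. f \<in> V \<Longrightarrow> (\<lambda>q. a * f q) \<in> V"
    and "\<And>s. (\<lambda>q. \<Sum>i\<le>N. c i q * s ^ i) \<in> V" and "i \<le> N"
  shows "c i \<in> V"
  using assms(3,4)
proof (induction N arbitrary: c i)
  case 0
  then show ?case by simp
next
  case (Suc N)
  have low: "c i \<in> V" if "i \<le> N" for i
  proof -
    define a where "a i = (2 :: complex) ^ i - 2 ^ Suc N" for i
    have "(\<lambda>q. \<Sum>i\<le>N. (a i * c i q) * s ^ i) \<in> V" for s
    proof -
      have "(\<lambda>q. (\<Sum>i\<le>Suc N. c i q * (2 * s) ^ i) + - (2 ^ Suc N) * (\<Sum>i\<le>Suc N. c i q * s ^ i)) \<in> V"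
        by (intro V Suc.prems(1))
      also have "(\<lambda>q. (\<Sum>i\<le>Suc N. c i q * (2 * s) ^ i) + - (2 ^ Suc N) * (\<Sum>i\<le>Suc N. c i q * s ^ i)) =
          (\<lambda>q. \<Sum>i\<le>Suc N. (a i * c i q) * s ^ i)"
        unfolding sum_distrib_left sum.distrib[symmetric]
        by (simp add: a_def power_mult_distrib algebra_simps)
      also have "\<dots> = (\<lambda>q. \<Sum>i\<le>N. (a i * c i q) * s ^ i)"
        by (simp add: a_def)
      finally show ?thesis .
    qed
    then have "(\<lambda>q. a i * c i q) \<in> V"
      using Suc.IH[of "\<lambda>i q. a i * c i q" i] that by simp
    from V(2)[OF this, of "inverse (a i)"] have "(\<lambda>q. inverse (a i) * (a i * c i q)) \<in> V" .
    moreover have "a i \<noteq> 0"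
    proof
      assume "a i = 0"
      then have "(of_nat (2 ^ i) :: complex) = of_nat (2 ^ Suc N)"
        by (simp add: a_def)
      then show False
        using that unfolding of_nat_eq_iff by (simp del: power_Suc)
    qed
    ultimately show ?thesis
      by (simp add: mult.assoc[symmetric])
  qed
  show ?case
  proof (cases "i \<le> N")
    case False
    \<comment> \<open>The top coefficient is the value at s = 1 minus the lower coefficients. Their
      sum is formed over subsets A for the sake of the induction.\<close>
    have "(\<lambda>q. \<Sum>i\<in>A. c i q) \<in> V" if "A \<subseteq> {..N}" for A
    proof -
      have "finite A" using that finite_subset by blast
      then show ?thesis
        using that
      proof induction
        case empty
        show ?case using V(2)[OF Suc.prems(1), of 0] by simp
      next
        case (insert x A)
        then show ?case using V(1)[OF low, of x] by simp
      qed
    qed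
    from V(2)[OF this[of "{..N}"], of "- 1"]
    have "(\<lambda>q. - 1 * (\<Sum>i\<le>N. c i q)) \<in> V" by simp
    from V(1)[OF this Suc.prems(1)[of 1]]
    have "(\<lambda>q. - 1 * (\<Sum>i\<le>N. c i q) + (\<Sum>i\<le>Suc N. c i q * 1 ^ i)) \<in> V" .
    moreover have "(\<lambda>q. - 1 * (\<Sum>i\<le>N. c i q) + (\<Sum>i\<le>Suc N. c i q * 1 ^ i)) = c (Suc N)"
      by simp
    moreover have "i = Suc N"
      using False Suc.prems(2) by simp
    ultimately show ?thesis
      by simp
  qed (rule low)
qed

lemma hamiltonians_lie_deriv:
  assumes "polynomial_flow (danielewski p) E" and "\<And>t. poisson_map p 1 (E t)"
    and "\<And>t. restrict (E t) (danielewski p) \<in> carrier (danielewski_group p)"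
    and H: "H \<in> hamiltonians p"
  shows "lie_deriv E H \<in> hamiltonians p"
proof -
  interpret polynomial_flow "danielewski p" E by fact
  have H': "H \<in> poly_funs affine_coords"
    using H by (simp add: hamiltonians_def)
  obtain P N where P: "\<And>q. degree (P q) \<le> N" "\<And>s q. H (E s q) = poly (P q) s"
    using flow_expand[OF H'] by metis
  have "(\<lambda>q. H (E s q)) \<in> hamiltonians p" for s
    by (rule hamiltonians_conjugate[OF H assms(2) polynomial_at flow_inverse(1) assms(3) assms(3)])
  \<comment> \<open>\<open>Suc N\<close> in place of N keeps the index 1 in range when N =
    0.\<close>
  moreover have "H (E s q) = (\<Sum>i\<le>Suc N. coeff (P q) i * s ^ i)" for s q
  proof -
    have "H (E s q) = (\<Sum>i\<le>degree (P q). coeff (P q) i * s ^ i)"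
      by (simp add: P(2) poly_altdef)
    also have "\<dots> = (\<Sum>i\<le>Suc N. coeff (P q) i * s ^ i)"
      by (intro sum.mono_neutral_left) (auto simp: coeff_eq_0 intro: le_SucI order_trans[OF _ P(1)[of q]])
    finally show ?thesis .
  qed
  ultimately have "(\<lambda>q. coeff (P q) 1) \<in> hamiltonians p"
    by (intro coefficients_in_span[where N = "Suc N" and c = "\<lambda>i q. coeff (P q) i"]
        hamiltonians_add hamiltonians_cmult) simp_all
  moreover have "lie_deriv E H = (\<lambda>q. coeff (P q) 1)"
  proof
    fix q
    have "((\<lambda>s. H (E s q)) has_field_derivative poly (pderiv (P q)) 0) (at 0)"
      unfolding P(2) by (rule poly_DERIV)
    then show "lie_deriv E H q = coeff (P q) 1"
      by (simp add: lie_deriv_def DERIV_imp_deriv poly_0_coeff_0 coeff_pderiv)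
  qed
  ultimately show ?thesis
    by simp
qed

section \<open>Hamiltonians of the form y^k f(z)\<close>

lemma partial_deriv_y_z:
  fixes q :: "complex ^ 3"
  shows "partial_deriv 1 (\<lambda>q. q $ 2 ^ k * poly f (q $ 3)) q = 0"
    "partial_deriv 2 (\<lambda>q. q $ 2 ^ k * poly f (q $ 3)) q = of_nat k * q $ 2 ^ (k - 1) * poly f (q $ 3)"
    "partial_deriv 3 (\<lambda>q. q $ 2 ^ k * poly f (q $ 3)) q = q $ 2 ^ k * poly (pderiv f) (q $ 3)"
  by (auto simp: partial_deriv_def intro!: DERIV_imp_deriv derivative_eq_intros)

lemma poly_funs_y_z: "(\<lambda>q :: complex ^ 3. q $ 2 ^ k * poly f (q $ 3)) \<in> poly_funs affine_coords"
  by (intro poly_funs_intros)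

text \<open>On functions of y and z alone, \<open>D3\<close> is y^2 d/dz.\<close>

lemma hamiltonians_step3:
  assumes "(\<lambda>q. q $ 2 ^ k * poly f (q $ 3)) \<in> hamiltonians p"
  shows "(\<lambda>q. q $ 2 ^ (k + 2) * poly (pderiv f) (q $ 3)) \<in> hamiltonians p"
proof -
  have "lie_deriv (flow3 p) (\<lambda>q. q $ 2 ^ k * poly f (q $ 3)) =
      (\<lambda>q. q $ 2 ^ (k + 2) * poly (pderiv f) (q $ 3))"
    by (auto simp: lie_deriv_flow3[OF poly_funs_y_z] field1_def partial_deriv_y_z power2_eq_square power_add)
  then show ?thesis
    using hamiltonians_lie_deriv[OF polynomial_flow_flow3 poisson_map_flow3 flows_in_danielewski_group(2) assms]
    by simp
qed

lemma hamiltonians_iterate3: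
  assumes "(\<lambda>q. q $ 2 ^ k * poly f (q $ 3)) \<in> hamiltonians p"
  shows "(\<lambda>q. q $ 2 ^ (k + 2 * n) * poly ((pderiv ^^ n) f) (q $ 3)) \<in> hamiltonians p"
proof (induction n)
  case (Suc n)
  then show ?case
    using hamiltonians_step3[OF Suc] by (simp add: add.commute)
qed (use assms in simp)

lemma lie_deriv_flow2:
  "F \<in> poly_funs affine_coords \<Longrightarrow> lie_deriv (swapped (flow1 p)) F = field2 p F"
  by (simp add: fun_eq_iff lie_deriv_swapped lie_deriv_flow1 poly_funs_swap field1_swap)

lemma hamiltonians_step2:
  assumes "(\<lambda>q. q $ 2 ^ Suc k) \<in> hamiltonians p"
  shows "(\<lambda>q. q $ 2 ^ k * poly (pderiv p) (q $ 3)) \<in> hamiltonians p"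
proof -
  let ?E = "swapped (flow1 p)"
  \<comment> \<open>The factor \<open>poly 1\<close> brings the pure power into the form y^k f(z);
    the term x d/dz of \<open>D2\<close> then drops out because f' = 0.\<close>
  have "lie_deriv ?E (\<lambda>q. q $ 2 ^ Suc k * poly 1 (q $ 3)) =
      (\<lambda>q. of_nat (Suc k) * (q $ 2 ^ k * poly (pderiv p) (q $ 3)))"
    unfolding lie_deriv_flow2[OF poly_funs_y_z] unfolding field2_def partial_deriv_y_z by (simp add: mult_ac)
  moreover have "lie_deriv ?E (\<lambda>q. q $ 2 ^ Suc k) \<in> hamiltonians p"
    by (rule hamiltonians_lie_deriv[OF polynomial_flow_swapped[OF polynomial_flow_flow1]
        poisson_map_flow2 flows_in_danielewski_group(3) assms])
  ultimately have "(\<lambda>q. of_nat (Suc k) * (q $ 2 ^ k * poly (pderiv p) (q $ 3))) \<in> hamiltonians p"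
    by simp
  from hamiltonians_cmult[OF this, of "inverse (of_nat (Suc k))"] show ?thesis
    by (simp add: mult.assoc[symmetric] del: of_nat_Suc)
qed

text \<open>
  The field \<open>D\<^sub>2\<close> turns \<open>y\<^bsup>k+1\<^esup>\<close> into \<open>y\<^bsup>k\<^esup> p'(z)\<close>, and \<open>\<nu> - 1\<close> applications of \<open>D\<^sub>3 = y\<^sup>2 \<partial>/\<partial>z + \<dots>\<close> turn
  the latter into a multiple of \<open>y\<^bsup>k+2\<nu>-2\<^esup>\<close>.
\<close>

lemma hamiltonians_power_step:
  assumes "degree p \<ge> 1" "(\<lambda>q. q $ 2 ^ Suc k) \<in> hamiltonians p"
  shows "(\<lambda>q. q $ 2 ^ (k + 2 * (degree p - 1))) \<in> hamiltonians p"
proof -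
  define n where "n = degree p - 1"
  let ?n = n
  let ?f = "(pderiv ^^ ?n) (pderiv p)"
  have "pderiv ?f = (pderiv ^^ Suc ?n) (pderiv p)"
    by simp
  also have "\<dots> = 0"
    by (rule higher_pderiv_eq_0) (simp add: degree_pderiv n_def)
  finally have "degree ?f = 0"
    by (simp add: pderiv_eq_0_iff)
  then obtain a where a: "?f = [:a:]"
    by (meson degree_eq_zeroE)
  \<comment> \<open>The constant is nonzero, being n! times the leading coefficient of p', whose
    degree is n.\<close>
  have "a = fact ?n * coeff (pderiv p) ?n"
    using poly_higher_pderiv_0[of ?n "pderiv p"] a by simp
  moreover have "degree (pderiv p) = ?n" "pderiv p \<noteq> 0"
    using assms(1) by (auto simp: degree_pderiv pderiv_eq_0_iff n_def)
  ultimately have "a \<noteq> 0"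
    using leading_coeff_0_iff[of "pderiv p"] by simp
  have "(\<lambda>q. q $ 2 ^ (k + 2 * ?n) * poly ?f (q $ 3)) \<in> hamiltonians p"
    by (intro hamiltonians_iterate3 hamiltonians_step2 assms(2))
  from hamiltonians_cmult[OF this, of "inverse a"] \<open>a \<noteq> 0\<close> show ?thesis
    unfolding n_def[symmetric] a by (simp add: mult.left_commute[of "inverse a"])
qed

lemma hamiltonians_powers:
  assumes "degree p \<ge> 2" and e: "e = 2 * degree p - 3"
  shows "(\<lambda>q. q $ 2 ^ Suc (j * e)) \<in> hamiltonians p"
    "(\<lambda>q. q $ 2 ^ (j * e) * poly (pderiv p) (q $ 3)) \<in> hamiltonians p"
proof -
  show *: "(\<lambda>q. q $ 2 ^ Suc (j * e)) \<in> hamiltonians p"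
  proof (induction j)
    case 0
    then show ?case using hamiltonians_y by simp
  next
    case (Suc j)
    \<comment> \<open>Degree at least 2 makes both truncated subtractions exact.\<close>
    have "j * e + 2 * (degree p - 1) = Suc (Suc j * e)"
      using assms by simp
    moreover have "degree p \<ge> 1"
      using assms(1) by simp
    ultimately show ?case
      using hamiltonians_power_step[OF _ Suc] by metis
  qed
  show "(\<lambda>q. q $ 2 ^ (j * e) * poly (pderiv p) (q $ 3)) \<in> hamiltonians p"
    by (rule hamiltonians_step2[OF *])
qed


section \<open>Local surjectivity of polynomial maps\<close>

text \<open>The unknowns are indexed by a finite set I because their number will be 2m with m
  arbitrary. A point is a function on the whole index type, of which only the values on I are
  seen.\<close>

definition var_coords :: "'i set \<Rightarrow> (('i \<Rightarrow> complex) \<Rightarrow> complex) set" where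
  "var_coords I = {\<lambda>\<tau>. \<tau> j | j. j \<in> I}"

lemma poly_funs_var: "j \<in> I \<Longrightarrow> (\<lambda>\<tau>. \<tau> j) \<in> poly_funs (var_coords I)"
  by (rule poly_funs.coord) (auto simp: var_coords_def)

lemma poly_funs_var_tendsto:
  assumes "f \<in> poly_funs (var_coords I)" and "\<And>j. j \<in> I \<Longrightarrow> ((\<lambda>k. T k j) \<longlongrightarrow> L j) N"
  shows "((\<lambda>k. f (T k)) \<longlongrightarrow> f L) N"
  using assms(1) by induction (auto simp: var_coords_def intro!: tendsto_intros assms(2))

text \<open>Pairs of points tending to (0, 0), measured on I only. Pairs are needed because a
  contraction estimate compares two arbitrary points near 0.\<close>

definition near_0 :: "'i set \<Rightarrow> (('i \<Rightarrow> complex) \<times> ('i \<Rightarrow> complex)) filter" where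
  "near_0 I = filtercomap (\<lambda>r. \<Sum>j\<in>I. norm (fst r j) + norm (snd r j)) (nhds 0)"

lemma near_0_tendsto:
  fixes I :: "'i set"
  assumes "finite I" "j \<in> I"
  shows "((\<lambda>r. fst r j) \<longlongrightarrow> 0) (near_0 I)" "((\<lambda>r. snd r j) \<longlongrightarrow> 0) (near_0 I)"
proof -
  let ?S = "\<lambda>r :: ('i \<Rightarrow> complex) \<times> ('i \<Rightarrow> complex). \<Sum>j\<in>I. norm (fst r j) + norm (snd r j)"
  have lim: "(?S \<longlongrightarrow> 0) (near_0 I)"
    unfolding near_0_def by (rule filterlim_filtercomap)
  have mem: "norm (fst r j) + norm (snd r j) \<le> ?S r" for r
    by (rule member_le_sum[OF assms(2) _ assms(1)]) simp
  have "norm (fst r j) \<le> ?S r" "norm (snd r j) \<le> ?S r" for r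
    using mem[of r] norm_ge_zero[of "fst r j"] norm_ge_zero[of "snd r j"] by linarith+
  then show "((\<lambda>r. fst r j) \<longlongrightarrow> 0) (near_0 I)" "((\<lambda>r. snd r j) \<longlongrightarrow> 0) (near_0 I)"
    by (intro Lim_null_comparison[OF always_eventually lim] allI; simp)+
qed

text \<open>Strict differentiability at 0 in the form of Hadamard's lemma. The coefficients arise by
  induction on f; for products the increment is split as (f \<sigma> - f \<tau>) g \<sigma> + f
  \<tau> (g \<sigma> - g \<tau>).\<close>

lemma poly_funs_increment:
  assumes "finite I" "f \<in> poly_funs (var_coords I)"
  shows "\<exists>a c. (\<forall>\<sigma> \<tau>. f \<sigma> - f \<tau> = (\<Sum>j\<in>I. a j (\<sigma>, \<tau>) * (\<sigma> j - \<tau> j))) \<and>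
    (\<forall>j\<in>I. (a j \<longlongrightarrow> c j) (near_0 I))"
  using assms(2)
proof induction
  case (coord b)
  then obtain k where k: "k \<in> I" "b = (\<lambda>\<tau>. \<tau> k)"
    by (auto simp: var_coords_def)
  have "(\<Sum>j\<in>I. (if j = k then 1 else 0) * (\<sigma> j - \<tau> j)) = \<sigma> k - \<tau> k" for \<sigma> \<tau> :: "'a \<Rightarrow> complex"
    using assms(1) k(1) by (simp add: if_distrib[of "\<lambda>x. x * _"] sum.delta cong: if_cong)
  then show ?case
    unfolding k(2)
    by (intro exI[of _ "\<lambda>j _. if j = k then 1 else 0"] exI[of _ "\<lambda>j. if j = k then 1 else 0"]) auto
next
  case (const x)
  show ?case
    by (intro exI[of _ "\<lambda>_ _. 0"] exI[of _ "\<lambda>_. 0"]) auto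
next
  case (add f g)
  then obtain a c a' c' where
    "\<forall>\<sigma> \<tau>. f \<sigma> - f \<tau> = (\<Sum>j\<in>I. a j (\<sigma>, \<tau>) * (\<sigma> j - \<tau> j))" "\<forall>j\<in>I. (a j \<longlongrightarrow> c j) (near_0 I)"
    "\<forall>\<sigma> \<tau>. g \<sigma> - g \<tau> = (\<Sum>j\<in>I. a' j (\<sigma>, \<tau>) * (\<sigma> j - \<tau> j))" "\<forall>j\<in>I. (a' j \<longlongrightarrow> c' j) (near_0 I)"
    by blast
  then show ?case
    by (intro exI[of _ "\<lambda>j r. a j r + a' j r"] exI[of _ "\<lambda>j. c j + c' j"])
      (auto simp: distrib_right sum.distrib add_diff_add intro: tendsto_add)
next
  case (mult f g)
  obtain a c where
    f: "\<And>\<sigma> \<tau>. f \<sigma> - f \<tau> = (\<Sum>j\<in>I. a j (\<sigma>, \<tau>) * (\<sigma> j - \<tau> j))" "\<And>j. j \<in> I \<Longrightarrow> (a j \<longlongrightarrow> c j) (near_0 I)"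
    using mult.IH(1) by blast
  obtain a' c' where
    g: "\<And>\<sigma> \<tau>. g \<sigma> - g \<tau> = (\<Sum>j\<in>I. a' j (\<sigma>, \<tau>) * (\<sigma> j - \<tau> j))" "\<And>j. j \<in> I \<Longrightarrow> (a' j \<longlongrightarrow> c' j) (near_0 I)"
    using mult.IH(2) by blast
  have "((\<lambda>r. g (fst r)) \<longlongrightarrow> g (\<lambda>_. 0)) (near_0 I)"
    using mult.hyps(2) by (rule poly_funs_var_tendsto) (rule near_0_tendsto(1)[OF assms(1)])
  moreover have "((\<lambda>r. f (snd r)) \<longlongrightarrow> f (\<lambda>_. 0)) (near_0 I)"
    using mult.hyps(1) by (rule poly_funs_var_tendsto) (rule near_0_tendsto(2)[OF assms(1)])
  ultimately have "((\<lambda>r. a j r * g (fst r) + f (snd r) * a' j r) \<longlongrightarrow> c j * g (\<lambda>_. 0) + f (\<lambda>_. 0) * c' j) (near_0 I)"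
    if "j \<in> I" for j
    using f(2)[OF that] g(2)[OF that] by (intro tendsto_intros)
  moreover have "f \<sigma> * g \<sigma> - f \<tau> * g \<tau> =
      (\<Sum>j\<in>I. (a j (\<sigma>, \<tau>) * g \<sigma> + f \<tau> * a' j (\<sigma>, \<tau>)) * (\<sigma> j - \<tau> j))" for \<sigma> \<tau>
  proof -
    have "f \<sigma> * g \<sigma> - f \<tau> * g \<tau> = (f \<sigma> - f \<tau>) * g \<sigma> + f \<tau> * (g \<sigma> - g \<tau>)"
      by (simp add: algebra_simps)
    also have "\<dots> = (\<Sum>j\<in>I. (a j (\<sigma>, \<tau>) * g \<sigma> + f \<tau> * a' j (\<sigma>, \<tau>)) * (\<sigma> j - \<tau> j))"
      unfolding f(1) g(1) sum_distrib_left sum_distrib_right sum.distrib[symmetric]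
      by (intro sum.cong) (simp_all add: algebra_simps)
    finally show ?thesis .
  qed
  ultimately show ?case
    by (intro exI[of _ "\<lambda>j r. a j r * g (fst r) + f (snd r) * a' j r"]
        exI[of _ "\<lambda>j. c j * g (\<lambda>_. 0) + f (\<lambda>_. 0) * c' j"]) simp
qed

lemma poly_funs_increment_derivative:
  assumes I: "finite I" and f: "f \<in> poly_funs (var_coords I)"
    and d: "\<And>j. j \<in> I \<Longrightarrow> ((\<lambda>s. f (\<lambda>k. if k = j then s else 0)) has_field_derivative d j) (at 0)"
  shows "\<exists>a. (\<forall>\<sigma> \<tau>. f \<sigma> - f \<tau> = (\<Sum>j\<in>I. a j (\<sigma>, \<tau>) * (\<sigma> j - \<tau> j))) \<and>
    (\<forall>j\<in>I. (a j \<longlongrightarrow> d j) (near_0 I))"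
proof -
  obtain a c where a: "\<And>\<sigma> \<tau>. f \<sigma> - f \<tau> = (\<Sum>j\<in>I. a j (\<sigma>, \<tau>) * (\<sigma> j - \<tau> j))"
    and c: "\<And>j. j \<in> I \<Longrightarrow> (a j \<longlongrightarrow> c j) (near_0 I)"
    using poly_funs_increment[OF I f] by blast
  have "c j = d j" if j: "j \<in> I" for j
  proof (rule LIM_unique)
    \<comment> \<open>With \<sigma> on the j-th axis and \<tau> = 0, only the j-th coefficient
      survives and equals the difference quotient, so its limit is the partial derivative.\<close>
    let ?e = "\<lambda>s k. if k = j then s else (0 :: complex)"
    have "(\<Sum>i\<in>I. norm (?e s i) + norm (0 :: complex)) = norm s" for s
    proof -
      have "(\<Sum>i\<in>I. norm (?e s i) + norm (0 :: complex)) = (\<Sum>i\<in>I. if i = j then norm s else 0)"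
        by (intro sum.cong) auto
      then show ?thesis
        using I j by simp
    qed
    then have "filterlim (\<lambda>s. (?e s, \<lambda>_. 0)) (near_0 I) (at 0)"
      unfolding near_0_def filterlim_filtercomap_iff o_def fst_conv snd_conv
      by (simp only: tendsto_norm_zero[OF tendsto_ident_at])
    then show "((\<lambda>s. a j (?e s, \<lambda>_. 0)) \<longlongrightarrow> c j) (at 0)"
      using c[OF j] by (rule filterlim_compose[rotated])
    have "f (?e s) - f (?e 0) = a j (?e s, \<lambda>_. 0) * s" for s
    proof -
      have "f (?e s) - f (?e 0) = (\<Sum>i\<in>I. if i = j then a j (?e s, \<lambda>_. 0) * s else 0)"
        unfolding a by (intro sum.cong) auto
      then show ?thesis
        using I j by simp
    qed
    then have "\<forall>\<^sub>F s in at 0. (f (?e s) - f (?e 0)) / (s - 0) = a j (?e s, \<lambda>_. 0)"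
      by (auto simp: eventually_at_filter)
    then show "((\<lambda>s. a j (?e s, \<lambda>_. 0)) \<longlongrightarrow> d j) (at 0)"
      using d[OF j] unfolding has_field_derivative_iff by (rule Lim_transform_eventually[rotated])
  qed
  with a c show ?thesis
    by (intro exI[of _ a]) simp
qed

text \<open>Since F has the identity as derivative at 0, the map \<sigma> - F \<sigma> + b contracts
  near 0. Its fixed points solve F \<sigma> = b, and iteration from 0 converges to one when b is
  close to F 0.\<close>

lemma poly_funs_local_surj:
  fixes F :: "'i \<Rightarrow> ('i \<Rightarrow> complex) \<Rightarrow> complex"
  assumes I: "finite I" and F: "\<And>i. i \<in> I \<Longrightarrow> F i \<in> poly_funs (var_coords I)"
    and D: "\<And>i j. i \<in> I \<Longrightarrow> j \<in> I \<Longrightarrow>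
      ((\<lambda>s. F i (\<lambda>k. if k = j then s else 0)) has_field_derivative (if i = j then 1 else 0)) (at 0)"
  shows "\<exists>\<delta>>0. \<forall>b. (\<forall>i\<in>I. norm (b i - F i (\<lambda>_. 0)) < \<delta>) \<longrightarrow> (\<exists>\<tau>. \<forall>i\<in>I. F i \<tau> = b i)"
proof -
  have "\<forall>i\<in>I. \<exists>a. (\<forall>\<sigma> \<tau>. F i \<sigma> - F i \<tau> = (\<Sum>j\<in>I. a j (\<sigma>, \<tau>) * (\<sigma> j - \<tau> j))) \<and>
      (\<forall>j\<in>I. (a j \<longlongrightarrow> (if i = j then 1 else 0)) (near_0 I))"
  proof
    fix i assume i: "i \<in> I"
    show "\<exists>a. (\<forall>\<sigma> \<tau>. F i \<sigma> - F i \<tau> = (\<Sum>j\<in>I. a j (\<sigma>, \<tau>) * (\<sigma> j - \<tau> j))) \<and>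
        (\<forall>j\<in>I. (a j \<longlongrightarrow> (if i = j then 1 else 0)) (near_0 I))"
      by (rule poly_funs_increment_derivative[OF I F[OF i] D[OF i]])
  qed
  from bchoice[OF this] obtain a where
    a: "\<And>i \<sigma> \<tau>. i \<in> I \<Longrightarrow> F i \<sigma> - F i \<tau> = (\<Sum>j\<in>I. a i j (\<sigma>, \<tau>) * (\<sigma> j - \<tau> j))"
    and lim: "\<And>i j. i \<in> I \<Longrightarrow> j \<in> I \<Longrightarrow> (a i j \<longlongrightarrow> (if i = j then 1 else 0)) (near_0 I)"
    by blast
  \<comment> \<open>In the norm n, the sum of absolute values, a matrix with entries at most
    \<epsilon> has norm at most |I| \<epsilon>, hence at most 1/2. Adding 1 to the cardinality
    covers empty I.\<close>
  define \<epsilon> where "\<epsilon> = 1 / (2 * (real (card I) + 1))"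
  have \<epsilon>: "\<epsilon> > 0" "real (card I) * \<epsilon> \<le> 1 / 2"
    by (auto simp: \<epsilon>_def field_simps)
  define n where "n \<sigma> = (\<Sum>j\<in>I. norm (\<sigma> j))" for \<sigma> :: "'i \<Rightarrow> complex"
  have "\<forall>\<^sub>F r in near_0 I. \<forall>i\<in>I. \<forall>j\<in>I. norm (a i j r - (if i = j then 1 else 0)) < \<epsilon>"
  proof (intro eventually_ball_finite I ballI)
    fix i j assume "i \<in> I" "j \<in> I"
    from tendstoD[OF lim[OF this] \<epsilon>(1)]
    show "\<forall>\<^sub>F r in near_0 I. norm (a i j r - (if i = j then 1 else 0)) < \<epsilon>"
      by (simp only: dist_norm)
  qed
  then have "\<exists>\<rho>>0. \<forall>\<sigma> \<tau>. n \<sigma> + n \<tau> < \<rho> \<longrightarrow>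
      (\<forall>i\<in>I. \<forall>j\<in>I. norm (a i j (\<sigma>, \<tau>) - (if i = j then 1 else 0)) < \<epsilon>)"
  proof -
    assume *: "\<forall>\<^sub>F r in near_0 I. \<forall>i\<in>I. \<forall>j\<in>I. norm (a i j r - (if i = j then 1 else 0)) < \<epsilon>"
    from * obtain Q where Q: "eventually Q (nhds (0 :: real))"
      "\<And>r. Q (\<Sum>j\<in>I. norm (fst r j) + norm (snd r j)) \<Longrightarrow>
        \<forall>i\<in>I. \<forall>j\<in>I. norm (a i j r - (if i = j then 1 else 0)) < \<epsilon>"
      unfolding near_0_def eventually_filtercomap by blast
    from Q(1) obtain \<rho> where \<rho>: "\<rho> > 0" "\<And>x. norm x < \<rho> \<Longrightarrow> Q x"
      unfolding eventually_nhds_metric dist_norm by auto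
    show ?thesis
    proof (intro exI[of _ \<rho>] conjI allI impI \<rho>(1))
      fix \<sigma> \<tau> assume h: "n \<sigma> + n \<tau> < \<rho>"
      have "(\<Sum>j\<in>I. norm (fst (\<sigma>, \<tau>) j) + norm (snd (\<sigma>, \<tau>) j)) = n \<sigma> + n \<tau>"
        by (simp add: n_def sum.distrib)
      moreover have "norm (n \<sigma> + n \<tau>) < \<rho>"
        using h by (simp add: n_def sum_nonneg)
      ultimately show "\<forall>i\<in>I. \<forall>j\<in>I. norm (a i j (\<sigma>, \<tau>) - (if i = j then 1 else 0)) < \<epsilon>"
        using Q(2)[of "(\<sigma>, \<tau>)"] \<rho>(2)[of "n \<sigma> + n \<tau>"] by simp
    qed
  qed
  then obtain \<rho> where \<rho>: "\<rho> > 0" and near: "\<And>\<sigma> \<tau> i j. n \<sigma> + n \<tau> < \<rho> \<Longrightarrow> i \<in> I \<Longrightarrow> j \<in> I \<Longrightarrow>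
      norm (a i j (\<sigma>, \<tau>) - (if i = j then 1 else 0)) < \<epsilon>"
    by blast
  \<comment> \<open>The first step then has length at most \<rho>/4 and the iterates have norm at
    most \<rho>/2, so that consecutive ones stay in the range of the contraction estimate.\<close>
  define \<delta> where "\<delta> = \<rho> / (4 * (real (card I) + 1))"
  have "\<delta> > 0"
    using \<rho> by (simp add: \<delta>_def)
  moreover have "\<exists>\<tau>. \<forall>i\<in>I. F i \<tau> = b i" if b: "\<forall>i\<in>I. norm (b i - F i (\<lambda>_. 0)) < \<delta>" for b
  proof -
    define G where "G \<sigma> i = \<sigma> i - F i \<sigma> + b i" for \<sigma> i
    have contraction: "n (\<lambda>i. G \<sigma> i - G \<tau> i) \<le> n (\<lambda>i. \<sigma> i - \<tau> i) / 2" if small: "n \<sigma> + n \<tau> < \<rho>" for \<sigma> \<tau>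
    proof -
      have "norm (G \<sigma> i - G \<tau> i) \<le> \<epsilon> * n (\<lambda>i. \<sigma> i - \<tau> i)" if i: "i \<in> I" for i
      proof -
        have eq: "\<sigma> i - \<tau> i = (\<Sum>j\<in>I. (if i = j then 1 else 0) * (\<sigma> j - \<tau> j))"
          using I i by (simp add: if_distrib[of "\<lambda>x. x * _"] sum.delta cong: if_cong)
        have "G \<sigma> i - G \<tau> i = (\<sigma> i - \<tau> i) - (F i \<sigma> - F i \<tau>)"
          by (simp add: G_def)
        also have "\<dots> = - (\<Sum>j\<in>I. (a i j (\<sigma>, \<tau>) - (if i = j then 1 else 0)) * (\<sigma> j - \<tau> j))"
          unfolding a[OF i] by (subst eq) (simp only: left_diff_distrib sum_subtractf minus_diff_eq)
        finally have "norm (G \<sigma> i - G \<tau> i) \<le>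
            (\<Sum>j\<in>I. norm ((a i j (\<sigma>, \<tau>) - (if i = j then 1 else 0)) * (\<sigma> j - \<tau> j)))"
          by (simp only: norm_minus_cancel norm_sum)
        also have "\<dots> \<le> (\<Sum>j\<in>I. \<epsilon> * norm (\<sigma> j - \<tau> j))"
          unfolding norm_mult
          by (intro sum_mono mult_right_mono less_imp_le[OF near[OF small i]] norm_ge_zero)
        finally show ?thesis
          by (simp add: n_def sum_distrib_left)
      qed
      then have "n (\<lambda>i. G \<sigma> i - G \<tau> i) \<le> (\<Sum>i\<in>I. \<epsilon> * n (\<lambda>i. \<sigma> i - \<tau> i))"
        unfolding n_def[of "\<lambda>i. G \<sigma> i - G \<tau> i"] by (rule sum_mono)
      also have "\<dots> = (real (card I) * \<epsilon>) * n (\<lambda>i. \<sigma> i - \<tau> i)"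
        by simp
      also have "\<dots> \<le> 1 / 2 * n (\<lambda>i. \<sigma> i - \<tau> i)"
        by (rule mult_right_mono[OF \<epsilon>(2)]) (simp add: n_def sum_nonneg)
      finally show ?thesis by simp
    qed
    define T where "T k = (G ^^ k) (\<lambda>_. 0)" for k
    have T: "T 0 = (\<lambda>_. 0)" "T (Suc k) = G (T k)" for k
      by (simp_all add: T_def)
    define \<eta> where "\<eta> = n (\<lambda>i. T 1 i - T 0 i)"
    have \<eta>: "0 \<le> \<eta>" "\<eta> \<le> \<rho> / 4"
    proof -
      show "0 \<le> \<eta>" by (simp add: \<eta>_def n_def sum_nonneg)
      have "\<eta> \<le> (\<Sum>i\<in>I. \<delta>)"
        unfolding \<eta>_def n_def
      proof (rule sum_mono)
        fix i assume "i \<in> I"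
        then show "norm (T 1 i - T 0 i) \<le> \<delta>"
          using b by (simp add: T_def G_def less_imp_le)
      qed
      also have "\<dots> \<le> \<rho> / 4"
        using \<rho> by (simp add: \<delta>_def field_simps)
      finally show "\<eta> \<le> \<rho> / 4" .
    qed
    have step: "n (\<lambda>i. T (Suc k) i - T k i) \<le> \<eta> * (1 / 2) ^ k \<and> n (T k) \<le> 2 * \<eta> * (1 - (1 / 2) ^ k)" for k
    proof (induction k)
      case 0
      show ?case by (simp add: \<eta>_def T n_def T_def)
    next
      case (Suc k)
      have tri: "n (T (Suc k)) \<le> n (T k) + n (\<lambda>i. T (Suc k) i - T k i)"
        unfolding n_def sum.distrib[symmetric] by (intro sum_mono) (metis add.commute diff_add_cancel norm_triangle_ineq)
      also have "\<dots> \<le> 2 * \<eta> * (1 - (1 / 2) ^ k) + \<eta> * (1 / 2) ^ k"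
        using Suc by simp
      also have "\<dots> = 2 * \<eta> * (1 - (1 / 2) ^ Suc k)"
        by (simp add: algebra_simps)
      finally have n: "n (T (Suc k)) \<le> 2 * \<eta> * (1 - (1 / 2) ^ Suc k)" .
      have bound: "2 * \<eta> * (1 - (1 / 2) ^ j) \<le> 2 * \<eta>" for j :: nat
        using \<eta>(1) by (intro mult_right_le_one_le) (auto simp: power_le_one)
      have "n (T (Suc k)) + n (T k) < \<rho>"
      \<comment> \<open>The contraction estimate needs a strict bound. For \<eta> > 0 it comes from
        \<open>n (T k)\<close> being strictly below 2 \<eta>; for \<eta> = 0 both norms
        vanish.\<close>
      proof (cases "\<eta> = 0")
        case True
        then show ?thesis using n Suc \<rho> by simp
      next
        case False
        have "2 * \<eta> * (1 - (1 / 2) ^ k) < 2 * \<eta>"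
          using \<eta>(1) False by simp
        then show ?thesis using n Suc bound[of "Suc k"] \<eta>(2) by linarith
      qed
      then have "n (\<lambda>i. T (Suc (Suc k)) i - T (Suc k) i) \<le> n (\<lambda>i. T (Suc k) i - T k i) / 2"
        unfolding T(2)[of "Suc k"] using contraction[of "T (Suc k)" "T k"] by (simp add: T(2))
      also have "\<dots> \<le> \<eta> * (1 / 2) ^ k / 2"
        using Suc by simp
      finally show ?case
        using n by simp
    qed
    define L where "L i = lim (\<lambda>k. T k i)" for i
    have "convergent (\<lambda>k. T k i)" if "i \<in> I" for i
    proof -
      have bound: "norm (T (Suc k) i - T k i) \<le> \<eta> * (1 / 2) ^ k" for k
      proof -
        have "norm (T (Suc k) i - T k i) \<le> n (\<lambda>i. T (Suc k) i - T k i)"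
          unfolding n_def by (rule member_le_sum[OF that _ I]) simp
        then show ?thesis using step[of k] by linarith
      qed
      have "summable (\<lambda>k. \<eta> * (1 / 2) ^ k)"
        by (rule summable_mult, rule summable_geometric) simp
      from summable_comparison_test'[OF this bound]
      have "summable (\<lambda>k. T (Suc k) i - T k i)" .
      then have "convergent (\<lambda>k. \<Sum>l<k. T (Suc l) i - T l i)"
        by (simp add: summable_iff_convergent)
      then show ?thesis
        by (simp add: sum_lessThan_telescope[of "\<lambda>k. T k i"] T(1))
    qed
    then have L: "(\<lambda>k. T k i) \<longlonglongrightarrow> L i" if "i \<in> I" for i
      using that by (simp add: L_def convergent_LIMSEQ_iff)
    have "F i L = b i" if i: "i \<in> I" for i
    proof -
      have "(\<lambda>k. T k i - F i (T k) + b i) \<longlonglongrightarrow> L i - F i L + b i"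
        by (intro tendsto_intros L i poly_funs_var_tendsto[OF F])
      moreover have "(\<lambda>k. T k i - F i (T k) + b i) = (\<lambda>k. T (Suc k) i)"
        by (simp add: T(2) G_def)
      moreover have "(\<lambda>k. T (Suc k) i) \<longlonglongrightarrow> L i"
        using L[OF i] by (rule LIMSEQ_Suc)
      ultimately have "L i - F i L + b i = L i"
        by (metis LIMSEQ_unique)
      then show ?thesis by (simp add: algebra_simps)
    qed
    then show ?thesis by blast
  qed
  ultimately show ?thesis
    by blast
qed


section \<open>Hamiltonian fields at generic tuples\<close>

lemma interpolation:
  fixes l v :: "nat \<Rightarrow> complex"
  assumes "inj_on l {..<m}"
  shows "\<exists>Q. \<forall>i<m. poly Q (l i) = v i"
  using assms
proof (induction m)
  case (Suc m)
  then obtain Q where Q: "\<And>i. i < m \<Longrightarrow> poly Q (l i) = v i"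
    by (auto simp: lessThan_Suc inj_on_insert)
  \<comment> \<open>Newton's correction term: it vanishes at the old nodes but not at the new
    one.\<close>
  define M where "M = (\<Prod>j<m. [:- l j, 1:])"
  have M: "poly M x = (\<Prod>j<m. x - l j)" for x
    by (simp add: M_def poly_prod)
  have "l m \<noteq> l j" if "j < m" for j
    using inj_onD[OF Suc.prems, of m j] that by auto
  then have "poly M (l m) \<noteq> 0"
    unfolding M by simp
  moreover have "poly M (l i) = 0" if "i < m" for i
    unfolding M using that by (auto intro!: prod_zero)
  ultimately show ?case
    by (intro exI[of _ "Q + smult ((v m - poly Q (l m)) / poly M (l m)) M"])
      (auto simp: less_Suc_eq Q)
qed simp

lemma bracket_sum:
  assumes "\<And>k. k \<in> A \<Longrightarrow> F k \<in> poly_funs affine_coords"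
  shows "bracket p (\<lambda>q. \<Sum>k\<in>A. F k q) H q = (\<Sum>k\<in>A. bracket p (F k) H q)"
  using assms
proof (induction A rule: infinite_finite_induct)
  case (insert x A)
  then show ?case by (simp add: bracket_add poly_funs_sum)
qed (simp_all add: bracket_def partial_deriv_def)

lemma bracket_linear_combination:
  assumes "\<And>k. F k \<in> poly_funs affine_coords"
  shows "bracket p (\<lambda>q. \<Sum>k\<in>A. c k * F k q) H q = (\<Sum>k\<in>A. c k * bracket p (F k) H q)"
proof -
  have "(\<lambda>q. c k * F k q) \<in> poly_funs affine_coords" for k
    using assms by (intro poly_funs.mult poly_funs.const)
  then show ?thesis
    by (simp add: bracket_sum bracket_cmult assms)
qed

lemma bracket_y_z:
  "bracket p (\<lambda>q. q $ 2 ^ k * poly f (q $ 3)) (\<lambda>q. q $ 2) q = - (q $ 2 ^ Suc k * poly (pderiv f) (q $ 3))"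
  "bracket p (\<lambda>q. q $ 2 ^ k * poly f (q $ 3)) (\<lambda>q. q $ 3) q = of_nat k * q $ 2 ^ k * poly f (q $ 3)"
  unfolding bracket_def partial_deriv_nth partial_deriv_y_z by (simp_all, cases k, simp_all)

text \<open>
  Where it does not vanish, the fields of \<open>y\<^bsup>1+je\<^esup>\<close> and \<open>y\<^bsup>je\<^esup> p'(z)\<close>, \<open>e = 2\<nu> - 3\<close>, span the tangent space.
\<close>

definition discriminant :: "complex poly \<Rightarrow> nat \<Rightarrow> (nat \<Rightarrow> complex ^ 3) \<Rightarrow> complex" where
  "discriminant p m w = (\<Prod>i<m. w i $ 2 * poly (pderiv (pderiv p)) (w i $ 3)) *
     (\<Prod>i<m. \<Prod>j<i. w i $ 2 ^ (2 * degree p - 3) - w j $ 2 ^ (2 * degree p - 3))"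

lemma discriminant_cong: "(\<And>i. i < m \<Longrightarrow> w i = w' i) \<Longrightarrow> discriminant p m w = discriminant p m w'"
  unfolding discriminant_def by (intro arg_cong2[of _ _ _ _ "(*)"] prod.cong) auto

lemma discriminant_nonzero:
  assumes "discriminant p m w \<noteq> 0"
  shows "\<And>i. i < m \<Longrightarrow> w i $ 2 \<noteq> 0" "\<And>i. i < m \<Longrightarrow> poly (pderiv (pderiv p)) (w i $ 3) \<noteq> 0"
    "inj_on (\<lambda>i. w i $ 2 ^ (2 * degree p - 3)) {..<m}"
proof -
  have 1: "w i $ 2 * poly (pderiv (pderiv p)) (w i $ 3) \<noteq> 0" if "i < m" for i
    using assms that by (auto simp: discriminant_def)
  then show "w i $ 2 \<noteq> 0" "poly (pderiv (pderiv p)) (w i $ 3) \<noteq> 0" if "i < m" for i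
    using that by auto
  have ne: "w i $ 2 ^ (2 * degree p - 3) \<noteq> w j $ 2 ^ (2 * degree p - 3)" if "i < m" "j < i" for i j
    using assms that by (force simp: discriminant_def)
  show "inj_on (\<lambda>i. w i $ 2 ^ (2 * degree p - 3)) {..<m}"
  proof (rule inj_onI)
    fix i j assume h: "i \<in> {..<m}" "j \<in> {..<m}" "w i $ 2 ^ (2 * degree p - 3) = w j $ 2 ^ (2 * degree p - 3)"
    then show "i = j"
      using ne[of i j] ne[of j i] by (cases i j rule: linorder_cases) auto
  qed
qed

lemma discriminant_poly_fun:
  assumes "\<And>k. k < m \<Longrightarrow> (\<lambda>r. w r k $ 2) \<in> poly_funs B" "\<And>k. k < m \<Longrightarrow> (\<lambda>r. w r k $ 3) \<in> poly_funs B"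
  shows "(\<lambda>r. discriminant p m (w r)) \<in> poly_funs B"
  unfolding discriminant_def
  by (intro poly_funs.mult poly_funs_prod poly_funs_diff poly_funs_power poly_funs_poly assms) auto

text \<open>The system is triangular. Q is chosen first so that \<open>B Q\<close> produces the
  velocities of y; then \<open>A R\<close>, which leaves y at rest, corrects the velocities of z.
  Both are interpolations at the distinct nodes y_i^e.\<close>

lemma hamiltonians_span:
  assumes deg: "degree p \<ge> 2" and w: "discriminant p m w \<noteq> 0"
  shows "\<exists>H \<in> hamiltonians p. \<forall>i<m.
    bracket p H (\<lambda>q. q $ 2) (w i) = \<alpha> i \<and> bracket p H (\<lambda>q. q $ 3) (w i) = \<beta> i"
proof -
  define e where "e = 2 * degree p - 3"
  have inj: "inj_on (\<lambda>i. w i $ 2 ^ e) {..<m}" and y: "\<And>i. i < m \<Longrightarrow> w i $ 2 \<noteq> 0"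
    and z: "\<And>i. i < m \<Longrightarrow> poly (pderiv (pderiv p)) (w i $ 3) \<noteq> 0"
    using discriminant_nonzero[OF w] by (auto simp: e_def)
  \<comment> \<open>The divisor cancels the exponent \<open>Suc (k * e)\<close> produced by
    differentiation in y, so that z moves with velocity y Q(y^e).\<close>
  define A where "A Q q = (\<Sum>k\<le>degree Q. coeff Q k / of_nat (Suc (k * e)) * (q $ 2 ^ Suc (k * e) * poly 1 (q $ 3)))"
    for Q and q :: "complex ^ 3"
  define B where "B Q q = (\<Sum>k\<le>degree Q. coeff Q k * (q $ 2 ^ (k * e) * poly (pderiv p) (q $ 3)))"
    for Q and q :: "complex ^ 3"
  have AB: "A Q \<in> hamiltonians p" "B Q \<in> hamiltonians p" for Q
    unfolding A_def[abs_def] B_def[abs_def]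
    using hamiltonians_powers[OF deg e_def]
    by (intro hamiltonians_sum hamiltonians_cmult; simp)+
  then have AB': "A Q \<in> poly_funs affine_coords" "B Q \<in> poly_funs affine_coords" for Q
    by (auto simp: hamiltonians_def)
  have A: "bracket p (A Q) (\<lambda>q. q $ 2) q = 0" "bracket p (A Q) (\<lambda>q. q $ 3) q = q $ 2 * poly Q (q $ 2 ^ e)" for Q q
  proof -
    show "bracket p (A Q) (\<lambda>q. q $ 2) q = 0"
      unfolding A_def[abs_def] bracket_linear_combination[OF poly_funs_y_z] bracket_y_z by simp
    have "bracket p (A Q) (\<lambda>q. q $ 3) q = (\<Sum>k\<le>degree Q. q $ 2 * (coeff Q k * (q $ 2 ^ e) ^ k))"
      unfolding A_def[abs_def] bracket_linear_combination[OF poly_funs_y_z] bracket_y_z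
      by (intro sum.cong) (simp_all add: power_mult[symmetric] mult.commute[of e] del: of_nat_Suc)
    then show "bracket p (A Q) (\<lambda>q. q $ 3) q = q $ 2 * poly Q (q $ 2 ^ e)"
      by (simp add: poly_altdef sum_distrib_left)
  qed
  have B: "bracket p (B Q) (\<lambda>q. q $ 2) q = - (q $ 2 * poly Q (q $ 2 ^ e) * poly (pderiv (pderiv p)) (q $ 3))" for Q q
  proof -
    have "bracket p (B Q) (\<lambda>q. q $ 2) q =
        (\<Sum>k\<le>degree Q. - (q $ 2 * poly (pderiv (pderiv p)) (q $ 3)) * (coeff Q k * (q $ 2 ^ e) ^ k))"
      unfolding B_def[abs_def] bracket_linear_combination[OF poly_funs_y_z] bracket_y_z
      by (intro sum.cong) (simp_all add: power_mult[symmetric] mult.commute[of e])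
    also have "\<dots> = - (q $ 2 * poly (pderiv (pderiv p)) (q $ 3)) * poly Q (q $ 2 ^ e)"
      by (simp only: poly_altdef sum_distrib_left)
    finally show ?thesis by simp
  qed
  obtain Q where Q: "\<And>i. i < m \<Longrightarrow>
      poly Q (w i $ 2 ^ e) = - \<alpha> i / (w i $ 2 * poly (pderiv (pderiv p)) (w i $ 3))"
    using interpolation[OF inj, of "\<lambda>i. - \<alpha> i / (w i $ 2 * poly (pderiv (pderiv p)) (w i $ 3))"] by blast
  obtain R where R: "\<And>i. i < m \<Longrightarrow>
      poly R (w i $ 2 ^ e) = (\<beta> i - bracket p (B Q) (\<lambda>q. q $ 3) (w i)) / w i $ 2"
    using interpolation[OF inj, of "\<lambda>i. (\<beta> i - bracket p (B Q) (\<lambda>q. q $ 3) (w i)) / w i $ 2"] by blast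
  show ?thesis
    by (rule bexI[of _ "\<lambda>q. A R q + B Q q"])
      (auto simp: bracket_add AB AB' A B Q R y z intro: hamiltonians_add)
qed


section \<open>Orbits of generic tuples\<close>

text \<open>Only indices below m are compared, so tuples may be arbitrary functions here;
  extensionality returns when orbits are formed.\<close>

definition related ::
    "complex poly \<Rightarrow> nat \<Rightarrow> (nat \<Rightarrow> complex ^ 3) \<Rightarrow> (nat \<Rightarrow> complex ^ 3) \<Rightarrow> bool" where
  "related p m w w' \<longleftrightarrow> (\<exists>g \<in> carrier (danielewski_group p). \<forall>k<m. g (w k) = w' k)"

lemma related_sym:
  assumes "related p m w w'" "\<And>k. k < m \<Longrightarrow> w k \<in> danielewski p"
  shows "related p m w' w"
proof -
  obtain g where g: "g \<in> carrier (danielewski_group p)" "\<And>k. k < m \<Longrightarrow> g (w k) = w' k"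
    using assms(1) by (auto simp: related_def)
  obtain h where h: "h \<in> carrier (danielewski_group p)"
    "\<And>q. q \<in> danielewski p \<Longrightarrow> h (g q) = q" "\<And>q. q \<in> danielewski p \<Longrightarrow> g (h q) = q"
    by (rule flow_group_inverse[OF g(1)]) (rule that)
  have "h (w' k) = w k" if "k < m" for k
    using h(2)[OF assms(2)[OF that]] g(2)[OF that] by simp
  then show ?thesis
    using h(1) by (auto simp: related_def)
qed

lemma related_trans:
  assumes "related p m w w'" "related p m w' w''" "\<And>k. k < m \<Longrightarrow> w k \<in> danielewski p"
  shows "related p m w w''"
proof -
  obtain g h where gh: "g \<in> carrier (danielewski_group p)" "\<And>k. k < m \<Longrightarrow> g (w k) = w' k"
    "h \<in> carrier (danielewski_group p)" "\<And>k. k < m \<Longrightarrow> h (w' k) = w'' k"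
    using assms(1,2) by (auto simp: related_def)
  show ?thesis
    unfolding related_def
    by (rule bexI[OF _ flow_group_compose[OF gh(3,1)]]) (auto simp: compose_def assms(3) gh)
qed

lemma danielewski_eqI:
  assumes "q \<in> danielewski p" "q' \<in> danielewski p" "q $ 2 = q' $ 2" "q $ 3 = q' $ 3" "q $ 2 \<noteq> 0"
  shows "q = q'"
proof (rule vec3_eqI)
  have "q $ 1 * q $ 2 = q' $ 1 * q $ 2"
    using assms(1-4) by (simp add: danielewski_def)
  then show "q $ 1 = q' $ 1"
    using assms(5) by simp
qed (use assms in auto)

text \<open>Every index gets its own time. As the list is distinct, on the j-th axis all factors but
  \<open>\<theta> j\<close> are the identity, so the partial derivatives at 0 are the prescribed
  velocities.\<close>

lemma integrates_product:
  fixes \<theta> :: "'i \<Rightarrow> complex \<Rightarrow> complex ^ 3 \<Rightarrow> complex ^ 3" and js :: "'i list"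
  assumes "\<And>j. j \<in> set js \<Longrightarrow> integrates p (\<theta> j) (H j)" and "distinct js"
  defines "\<Psi> \<equiv> \<lambda>\<tau> q. foldr (\<lambda>j. \<theta> j (\<tau> j)) js q"
  shows "(\<lambda>\<tau>. \<Psi> \<tau> q $ i) \<in> poly_funs (var_coords (set js))"
    "restrict (\<Psi> \<tau>) (danielewski p) \<in> carrier (danielewski_group p)"
    "\<Psi> (\<lambda>_. 0) q = q"
    "j \<in> set js \<Longrightarrow> \<Psi> (\<lambda>k. if k = j then s else 0) q = \<theta> j s q"
proof -
  have id: "foldr (\<lambda>j. \<theta> j (\<tau> j)) ks q = q" if "set ks \<subseteq> set js" "\<And>j. j \<in> set ks \<Longrightarrow> \<tau> j = 0" for ks \<tau> q
    using that by (induction ks) (auto simp: integratesD(3)[OF assms(1)])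
  then show "\<Psi> (\<lambda>_. 0) q = q"
    by (simp add: \<Psi>_def)
  have "(\<lambda>\<tau>. foldr (\<lambda>j. \<theta> j (\<tau> j)) ks q $ i) \<in> poly_funs (var_coords (set js))" if "set ks \<subseteq> set js" for ks i
    using that
  proof (induction ks arbitrary: i)
    case (Cons j ks)
    have "(\<lambda>\<tau>. (\<lambda>r. \<theta> j (fst r) (snd r) $ i) (\<tau> j, foldr (\<lambda>j. \<theta> j (\<tau> j)) ks q)) \<in> poly_funs (var_coords (set js))"
    proof (rule poly_funs_subst[of "\<lambda>r. \<theta> j (fst r) (snd r) $ i" time_coords
          "\<lambda>\<tau>. (\<tau> j, foldr (\<lambda>j. \<theta> j (\<tau> j)) ks q)"])
      show "(\<lambda>r. \<theta> j (fst r) (snd r) $ i) \<in> poly_funs time_coords"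
        using Cons.prems by (intro integratesD(1)[OF assms(1)]) simp
      fix b :: "complex \<times> (complex ^ 3) \<Rightarrow> complex" assume "b \<in> time_coords"
      then show "(\<lambda>\<tau>. b (\<tau> j, foldr (\<lambda>j. \<theta> j (\<tau> j)) ks q)) \<in> poly_funs (var_coords (set js))"
        using Cons by (elim time_coordsE) (auto intro: poly_funs_var)
    qed
    then show ?case by simp
  qed (simp add: poly_funs.const)
  from this[of js i] show "(\<lambda>\<tau>. \<Psi> \<tau> q $ i) \<in> poly_funs (var_coords (set js))"
    by (simp add: \<Psi>_def)
  have "restrict (foldr (\<lambda>j. \<theta> j (\<tau> j)) ks) (danielewski p) \<in> carrier (danielewski_group p)" if "set ks \<subseteq> set js" for ks
    using that
  proof (induction ks)
    case Nil
    show ?case unfolding foldr.simps id_def by (rule flow_group_id)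
  next
    case (Cons j ks)
    then have "restrict (\<theta> j (\<tau> j)) (danielewski p) \<in> carrier (danielewski_group p)"
      by (intro integratesD(2)[OF assms(1)]) simp
    moreover have "restrict (foldr (\<lambda>j. \<theta> j (\<tau> j)) ks) (danielewski p) \<in> carrier (danielewski_group p)"
      by (rule Cons.IH) (use Cons.prems in simp)
    ultimately show ?case
      unfolding foldr.simps o_def by (rule flow_group_restrict_compose)
  qed
  from this[of js] show "restrict (\<Psi> \<tau>) (danielewski p) \<in> carrier (danielewski_group p)"
    unfolding \<Psi>_def by blast
  have "foldr (\<lambda>k. \<theta> k (if k = j then s else 0)) ks q = \<theta> j s q"
    if "set ks \<subseteq> set js" "distinct ks" "j \<in> set ks" for ks
    using that
  proof (induction ks)
    case (Cons k ks)
    show ?case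
    proof (cases "k = j")
      case True
      have "foldr (\<lambda>k. \<theta> k (if k = j then s else 0)) ks q = q"
        by (rule id) (use Cons.prems True in auto)
      with True show ?thesis by simp
    next
      case False
      then show ?thesis using Cons integratesD(3)[OF assms(1), of k] by simp
    qed
  qed simp
  from this[of js] show "j \<in> set js \<Longrightarrow> \<Psi> (\<lambda>k. if k = j then s else 0) q = \<theta> j s q"
    using assms(2) by (simp add: \<Psi>_def)
qed

text \<open>Where no y_k vanishes, the y_k and z_k are coordinates on Y^m. For each of these 2m
  coordinates a family is chosen that moves it with velocity 1 and the others with velocity 0 at w,
  so the product has the identity as its derivative in the times.\<close>

lemma generic_orbit_open:
  assumes deg: "degree p \<ge> 2" and w: "discriminant p m w \<noteq> 0" "\<And>k. k < m \<Longrightarrow> w k \<in> danielewski p"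
  shows "\<exists>\<delta>>0. \<forall>w'. (\<forall>k<m. w' k \<in> danielewski p \<and> w' k $ 2 \<noteq> 0 \<and>
      norm (w' k $ 2 - w k $ 2) < \<delta> \<and> norm (w' k $ 3 - w k $ 3) < \<delta>) \<longrightarrow> related p m w w'"
proof -
  \<comment> \<open>\<open>True\<close> stands for y and \<open>False\<close> for z. The same pairs
    index the coordinates and the times, as \<open>poly_funs_local_surj\<close> requires.\<close>
  define I :: "(nat \<times> bool) set" where "I = {..<m} \<times> UNIV"
  define c :: "bool \<Rightarrow> 3" where "c b = (if b then 2 else 3)" for b
  have I: "finite I" by (simp add: I_def)
  have "\<exists>\<theta>. \<exists>H. integrates p \<theta> H \<and> (\<forall>k\<in>I. bracket p H (\<lambda>q. q $ c (snd k)) (w (fst k)) = (if k = j then 1 else 0))" for j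
  proof -
    obtain H where H: "H \<in> hamiltonians p"
      "\<And>i. i < m \<Longrightarrow> bracket p H (\<lambda>q. q $ 2) (w i) = (if (i, True) = j then 1 else 0)"
      "\<And>i. i < m \<Longrightarrow> bracket p H (\<lambda>q. q $ 3) (w i) = (if (i, False) = j then 1 else 0)"
      using hamiltonians_span[OF deg w(1), of "\<lambda>i. if (i, True) = j then 1 else 0" "\<lambda>i. if (i, False) = j then 1 else 0"]
      by blast
    then obtain \<theta> where "integrates p \<theta> H"
      by (auto simp: hamiltonians_def)
    then show ?thesis
      using H(2,3) by (intro exI[of _ \<theta>] exI[of _ H]) (auto simp: I_def c_def)
  qed
  then obtain \<theta> H where \<theta>: "\<And>j. integrates p (\<theta> j) (H j)"
    and H: "\<And>j k. k \<in> I \<Longrightarrow> bracket p (H j) (\<lambda>q. q $ c (snd k)) (w (fst k)) = (if k = j then 1 else 0)"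
    by metis
  obtain js where js: "set js = I" "distinct js"
    using finite_distinct_list[OF I] by blast
  define \<Psi> where "\<Psi> \<tau> = foldr (\<lambda>j. \<theta> j (\<tau> j)) js" for \<tau>
  note \<Psi> = integrates_product[of js p \<theta> H, OF \<theta> js(2), folded \<Psi>_def, unfolded js(1)]
  define F where "F k \<tau> = \<Psi> \<tau> (w (fst k)) $ c (snd k)" for k \<tau>
  have F: "F k \<in> poly_funs (var_coords I)" for k
    unfolding F_def[abs_def] by (rule \<Psi>(1))
  have D: "((\<lambda>s. F i (\<lambda>k. if k = j then s else 0)) has_field_derivative (if i = j then 1 else 0)) (at 0)"
    if "i \<in> I" "j \<in> I" for i j
    using integratesD(4)[OF \<theta>, of j "w (fst i)" "c (snd i)"] H[OF that(1), of j]
    by (simp add: F_def \<Psi>(4)[OF that(2)])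
  obtain \<delta> where \<delta>: "\<delta> > 0"
    "\<And>b. \<forall>i\<in>I. norm (b i - F i (\<lambda>_. 0)) < \<delta> \<Longrightarrow> \<exists>\<tau>. \<forall>i\<in>I. F i \<tau> = b i"
    using poly_funs_local_surj[OF I F D] by blast
  show ?thesis
  proof (intro exI[of _ \<delta>] conjI \<delta>(1) allI impI)
    fix w' assume w': "\<forall>k<m. w' k \<in> danielewski p \<and> w' k $ 2 \<noteq> 0 \<and>
      norm (w' k $ 2 - w k $ 2) < \<delta> \<and> norm (w' k $ 3 - w k $ 3) < \<delta>"
    have "\<exists>\<tau>. \<forall>i\<in>I. F i \<tau> = w' (fst i) $ c (snd i)"
      by (rule \<delta>(2)) (use w' in \<open>auto simp: F_def \<Psi>(3) I_def c_def\<close>)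
    then obtain \<tau> where \<tau>: "\<And>k b. k < m \<Longrightarrow> \<Psi> \<tau> (w k) $ c b = w' k $ c b"
      by (force simp: F_def I_def)
    have "restrict (\<Psi> \<tau>) (danielewski p) (w k) = w' k" if "k < m" for k
    proof (rule danielewski_eqI)
      show "restrict (\<Psi> \<tau>) (danielewski p) (w k) \<in> danielewski p"
        by (rule flow_group_closed[OF \<Psi>(2) w(2)[OF that]])
    qed (use w' that w(2)[OF that] \<tau>[OF that, of True] \<tau>[OF that, of False] in \<open>auto simp: c_def\<close>)
    then show "related p m w w'"
      unfolding related_def using \<Psi>(2) by blast
  qed
qed

section \<open>All generic tuples lie in one orbit\<close>

lemma poly_funs_ident: "f \<in> poly_funs {\<lambda>s. s} \<Longrightarrow> \<exists>R. f = poly R"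
proof (induction rule: poly_funs.induct)
  case (coord b)
  then show ?case by (intro exI[of _ "[:0, 1:]"]) auto
next
  case (const c)
  then show ?case by (intro exI[of _ "[:c:]"]) auto
next
  case (add f g)
  then obtain R S where "f = poly R" "g = poly S" by blast
  then show ?case by (intro exI[of _ "R + S"]) auto
next
  case (mult f g)
  then obtain R S where "f = poly R" "g = poly S" by blast
  then show ?case by (intro exI[of _ "R * S"]) auto
qed

text \<open>
  In the coordinates \<open>(y, z)\<close>, a complex line through two generic tuples meets the complement of the
  generic locus in finitely many points, and the open orbits cannot separate the connected rest.
\<close>

lemma generic_related:
  assumes deg: "degree p \<ge> 2"
    and w: "discriminant p m w \<noteq> 0" "\<And>k. k < m \<Longrightarrow> w k \<in> danielewski p"
    and w': "discriminant p m w' \<noteq> 0" "\<And>k. k < m \<Longrightarrow> w' k \<in> danielewski p"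
  shows "related p m w w'"
proof -
  define y where "y s k = w k $ 2 + s * (w' k $ 2 - w k $ 2)" for s k
  define z where "z s k = w k $ 3 + s * (w' k $ 3 - w k $ 3)" for s k
  \<comment> \<open>The first coordinate is forced by the equation of Y as long as y is nonzero,
    which \<open>y0\<close> provides on S.\<close>
  define P :: "complex \<Rightarrow> nat \<Rightarrow> complex ^ 3" where "P s k = vector [poly p (z s k) / y s k, y s k, z s k]" for s k
  have P: "P s k $ 1 = poly p (z s k) / y s k" "P s k $ 2 = y s k" "P s k $ 3 = z s k" for s k
    by (simp_all add: P_def)
  have id: "(\<lambda>s. s) \<in> poly_funs {\<lambda>s :: complex. s}"
    by (rule poly_funs.coord) simp
  \<comment> \<open>The discriminant involves y and z, which are affine in s, and not the quotient
    in the first coordinate.\<close>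
  have "(\<lambda>s. discriminant p m (P s)) \<in> poly_funs {\<lambda>s. s}"
    by (rule discriminant_poly_fun; unfold P y_def z_def)
      (intro poly_funs.add poly_funs.mult poly_funs.const id)+
  then obtain R where R: "\<And>s. discriminant p m (P s) = poly R s"
    using poly_funs_ident by (metis (no_types))
  define S where "S = - {s. poly R s = 0}"
  have P01: "P 0 k = w k" "P 1 k = w' k" if "k < m" for k
    using w(2)[OF that] w'(2)[OF that] discriminant_nonzero(1)[OF w(1) that] discriminant_nonzero(1)[OF w'(1) that]
    by (auto intro!: vec3_eqI simp: P y_def z_def danielewski_def field_simps)
  have ends: "0 \<in> S" "1 \<in> S"
    using discriminant_cong[of m "P 0" w p] discriminant_cong[of m "P 1" w' p] P01 w(1) w'(1)
    by (auto simp: S_def R[symmetric])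
  \<comment> \<open>R is not the zero polynomial because it does not vanish at 0. Removing finitely
    many points leaves the complex plane path connected.\<close>
  have "finite {s. poly R s = 0}"
    using ends(1) by (intro poly_roots_finite) (auto simp: S_def)
  then have "connected S"
    unfolding S_def by (intro path_connected_imp_connected path_connected_complement_countable)
      (auto simp: countable_finite)
  have y0: "y s k \<noteq> 0" if "s \<in> S" "k < m" for s k
    using discriminant_nonzero(1)[of p m "P s", OF _ that(2)] that(1) by (simp add: P S_def R)
  have PY: "P s k \<in> danielewski p" if "s \<in> S" "k < m" for s k
    using y0[OF that] by (simp add: danielewski_def P)
  have "related p m (P 0) (P 1)"
    using \<open>connected S\<close> ends
  proof (rule connected_equivalence_relation)
    fix s t assume "related p m (P s) (P t)" "s \<in> S" "t \<in> S"
    then show "related p m (P t) (P s)"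
      using related_sym PY by blast
  next
    fix r s t assume "related p m (P r) (P s)" "related p m (P s) (P t)" "r \<in> S" "s \<in> S" "t \<in> S"
    then show "related p m (P r) (P t)"
      using related_trans PY by blast
  next
    fix a assume a: "a \<in> S"
    then have d: "discriminant p m (P a) \<noteq> 0"
      by (simp add: S_def R)
    obtain \<delta> where \<delta>: "\<delta> > 0" "\<And>w'. \<forall>k<m. w' k \<in> danielewski p \<and> w' k $ 2 \<noteq> 0 \<and>
        norm (w' k $ 2 - P a k $ 2) < \<delta> \<and> norm (w' k $ 3 - P a k $ 3) < \<delta> \<Longrightarrow> related p m (P a) w'"
      using generic_orbit_open[OF deg d PY[OF a]] by blast
    \<comment> \<open>A bound for the speed of every y_k and z_k along the line, made positive by
      the summand 1. Parameters closer to a than \<delta> / C move each coordinate by less than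
      \<delta>.\<close>
    define C where "C = 1 + (\<Sum>k<m. norm (w' k $ 2 - w k $ 2) + norm (w' k $ 3 - w k $ 3))"
    have C: "C > 0"
      unfolding C_def by (intro add_pos_nonneg sum_nonneg) auto
    have Ck: "norm (w' k $ 2 - w k $ 2) \<le> C" "norm (w' k $ 3 - w k $ 3) \<le> C" if "k < m" for k
    proof -
      have "norm (w' k $ 2 - w k $ 2) + norm (w' k $ 3 - w k $ 3) \<le>
          (\<Sum>k<m. norm (w' k $ 2 - w k $ 2) + norm (w' k $ 3 - w k $ 3))"
        by (rule member_le_sum[of k "{..<m}" "\<lambda>k. norm (w' k $ 2 - w k $ 2) + norm (w' k $ 3 - w k $ 3)"])
          (use that in auto)
      then show "norm (w' k $ 2 - w k $ 2) \<le> C" "norm (w' k $ 3 - w k $ 3) \<le> C"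
        unfolding C_def using norm_ge_zero[of "w' k $ 2 - w k $ 2"] norm_ge_zero[of "w' k $ 3 - w k $ 3"]
        by linarith+
    qed
    have "related p m (P a) (P s)" if s: "s \<in> S \<inter> ball a (\<delta> / C)" for s
    proof (rule \<delta>(2), intro allI impI)
      fix k assume k: "k < m"
      have "norm (s - a) * C < \<delta>"
        using s C by (simp add: dist_norm norm_minus_commute field_simps)
      then have *: "norm ((s - a) * u) < \<delta>" if "norm u \<le> C" for u
        using mult_left_mono[OF that, of "norm (s - a)"] by (simp add: norm_mult)
      have "P s k $ 2 - P a k $ 2 = (s - a) * (w' k $ 2 - w k $ 2)"
        "P s k $ 3 - P a k $ 3 = (s - a) * (w' k $ 3 - w k $ 3)"
        by (simp_all add: P y_def z_def algebra_simps)
      then show "P s k \<in> danielewski p \<and> P s k $ 2 \<noteq> 0 \<and>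
          norm (P s k $ 2 - P a k $ 2) < \<delta> \<and> norm (P s k $ 3 - P a k $ 3) < \<delta>"
        using PY[of s k] y0[of s k] s k * Ck by (simp add: P)
    qed
    then show "\<exists>T. openin (top_of_set S) T \<and> a \<in> T \<and> (\<forall>s\<in>T. related p m (P a) (P s))"
      using a \<delta>(1) C by (intro exI[of _ "S \<inter> ball a (\<delta> / C)"]) (auto intro: openin_open_Int)
  qed
  then show ?thesis
    using P01 by (simp add: related_def)
qed

section \<open>Existence of generic tuples, and Zariski openness of their orbit\<close>

lemma generic_exists:
  assumes "degree p \<ge> 2"
  obtains w where "w \<in> cart_power (danielewski p) m" "discriminant p m w \<noteq> 0"
proof -
  let ?e = "2 * degree p - 3"
  have "pderiv (pderiv p) \<noteq> 0"
    using assms by (simp add: pderiv_eq_0_iff degree_pderiv)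
  then have "finite {c. poly (pderiv (pderiv p)) c = 0}"
    by (rule poly_roots_finite)
  then obtain c where c: "poly (pderiv (pderiv p)) c \<noteq> 0"
    using infinite_UNIV_char_0 by (metis (mono_tags, lifting) UNIV_eq_I mem_Collect_eq)
  \<comment> \<open>All points share a z outside the zeros of p'' and have y = k + 1; the e-th
    powers of these integers are distinct because e >= 1.\<close>
  define v :: "nat \<Rightarrow> complex ^ 3" where
    "v k = vector [poly p c / of_nat (Suc k), of_nat (Suc k), c]" for k
  have v: "v k $ 1 = poly p c / of_nat (Suc k)" "v k $ 2 = of_nat (Suc k)" "v k $ 3 = c" for k
    by (simp_all add: v_def)
  have "v i $ 2 ^ ?e - v j $ 2 ^ ?e \<noteq> 0" if "j < i" for i j
  proof -
    have "Suc j ^ ?e < Suc i ^ ?e"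
      using that assms by (intro power_strict_mono) auto
    then have "(of_nat (Suc i ^ ?e) :: complex) \<noteq> of_nat (Suc j ^ ?e)"
      unfolding of_nat_eq_iff by simp
    then show ?thesis
      unfolding v by simp
  qed
  then have "discriminant p m v \<noteq> 0"
    unfolding discriminant_def using c by (auto simp: v(2,3) simp del: of_nat_Suc)
  then have "discriminant p m (restrict v {..<m}) \<noteq> 0"
    using discriminant_cong[of m v "restrict v {..<m}" p] by simp
  moreover have "restrict v {..<m} \<in> cart_power (danielewski p) m"
    by (auto simp: cart_power_def danielewski_def v simp del: of_nat_Suc)
  ultimately show ?thesis
    using that by blast
qed

text \<open>A member of the orbit is carried back to w by an inverse. Conversely, if g carries v to
  a generic tuple, \<open>generic_related\<close> joins that tuple to w.\<close>

lemma generic_orbit: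
  assumes deg: "degree p \<ge> 2"
    and w: "w \<in> cart_power (danielewski p) m" "discriminant p m w \<noteq> 0"
  shows "orbit (danielewski_group p) (diagonal_action (danielewski p) m (\<lambda>\<phi>. \<phi>)) w =
    {v \<in> cart_power (danielewski p) m. \<exists>g \<in> carrier (danielewski_group p). discriminant p m (\<lambda>k. g (v k)) \<noteq> 0}"
    (is "?O = ?U")
proof -
  let ?Y = "danielewski p" and ?G = "carrier (danielewski_group p)"
  have wY: "\<And>k. k < m \<Longrightarrow> w k \<in> ?Y"
    using w(1) by (auto simp: cart_power_def)
  have O: "v \<in> ?O \<longleftrightarrow> v \<in> cart_power ?Y m \<and> related p m w v" for v
  proof
    assume "v \<in> ?O"
    then obtain g where g: "g \<in> ?G" "v = (\<lambda>k\<in>{..<m}. g (w k))"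
      using w(1) by (auto simp: orbit_def diagonal_action_def)
    then show "v \<in> cart_power ?Y m \<and> related p m w v"
      using flow_group_closed[OF g(1) wY] by (auto simp: cart_power_def related_def)
  next
    assume v: "v \<in> cart_power ?Y m \<and> related p m w v"
    then obtain g where g: "g \<in> ?G" "\<And>k. k < m \<Longrightarrow> g (w k) = v k"
      by (auto simp: related_def)
    have "v = (\<lambda>k\<in>{..<m}. g (w k))"
      using v g(2) by (auto simp: cart_power_def PiE_def extensional_def)
    then show "v \<in> ?O"
      using w(1) g(1) by (auto simp: orbit_def diagonal_action_def)
  qed
  show ?thesis
  proof (rule equalityI; rule subsetI)
    fix v assume "v \<in> ?O"
    then have v: "v \<in> cart_power ?Y m" "related p m w v"
      using O by auto
    from related_sym[OF v(2) wY] obtain g where g: "g \<in> ?G" "\<And>k. k < m \<Longrightarrow> g (v k) = w k"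
      by (auto simp: related_def)
    then show "v \<in> ?U"
      using v(1) w(2) discriminant_cong[of m "\<lambda>k. g (v k)" w p] by (auto intro!: bexI[of _ g])
  next
    fix v assume "v \<in> ?U"
    then obtain g where v: "v \<in> cart_power ?Y m" and g: "g \<in> ?G" "discriminant p m (\<lambda>k. g (v k)) \<noteq> 0"
      by blast
    have vY: "\<And>k. k < m \<Longrightarrow> v k \<in> ?Y"
      using v by (auto simp: cart_power_def)
    have "related p m v (\<lambda>k. g (v k))"
      using g(1) by (auto simp: related_def)
    moreover have "related p m (\<lambda>k. g (v k)) w"
      using generic_related[OF deg g(2) _ w(2) wY] flow_group_closed[OF g(1) vY] by blast
    ultimately have "related p m v w"
      using related_trans vY by blast
    then show "v \<in> ?O"
      using O v related_sym vY by blast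
  qed
qed

lemma generic_orbit_zariski_open:
  assumes "degree p \<ge> 2" "w \<in> cart_power (danielewski p) m" "discriminant p m w \<noteq> 0"
  shows "zariski_open_in_power (danielewski p) m
    (orbit (danielewski_group p) (diagonal_action (danielewski p) m (\<lambda>\<phi>. \<phi>)) w)"
proof -
  let ?Y = "danielewski p" and ?G = "carrier (danielewski_group p)"
  \<comment> \<open>A group element is polynomial only through an extension from Y to the ambient
    space. Hence the members of S have to agree with the translated discriminants on Y^m
    only.\<close>
  define S where "S = {f \<in> poly_funs (power_coords m). \<exists>g\<in>?G. \<forall>v \<in> cart_power ?Y m.
    f v = discriminant p m (\<lambda>k. g (v k))}"
  have S: "\<exists>f\<in>S. \<forall>v \<in> cart_power ?Y m. f v = discriminant p m (\<lambda>k. g (v k))" if g: "g \<in> ?G" for g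
  proof -
    obtain \<Phi> where \<Phi>: "\<And>i. (\<lambda>q. \<Phi> q $ i) \<in> poly_funs affine_coords" "\<And>q. q \<in> ?Y \<Longrightarrow> \<Phi> q = g q"
      by (rule regular_map_polynomial[OF flow_group_regular[OF g]]) (rule that)
    have "(\<lambda>v. v k $ i) \<in> poly_funs (power_coords m)" if "k < m" for k and i :: 3
      using that by (intro poly_funs.coord) (auto simp: power_coords_def)
    then have "(\<lambda>v. \<Phi> (v k) $ i) \<in> poly_funs (power_coords m)" if "k < m" for k i
      using that by (intro poly_funs_affine_subst[OF \<Phi>(1)])
    then have "(\<lambda>v. discriminant p m (\<lambda>k. \<Phi> (v k))) \<in> poly_funs (power_coords m)"
      by (intro discriminant_poly_fun)
    moreover have "discriminant p m (\<lambda>k. \<Phi> (v k)) = discriminant p m (\<lambda>k. g (v k))"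
      if "v \<in> cart_power ?Y m" for v
      using that by (intro discriminant_cong \<Phi>(2)) (auto simp: cart_power_def)
    ultimately show ?thesis
      using g by (intro bexI[of _ "\<lambda>v. discriminant p m (\<lambda>k. \<Phi> (v k))"]) (auto simp: S_def)
  qed
  have "cart_power ?Y m - {v \<in> cart_power ?Y m. \<exists>g\<in>?G. discriminant p m (\<lambda>k. g (v k)) \<noteq> 0} =
      {v \<in> cart_power ?Y m. \<forall>f\<in>S. f v = 0}" (is "?L = ?R")
  proof
    show "?L \<subseteq> ?R"
      by (auto simp: S_def)
    show "?R \<subseteq> ?L"
    proof
      fix v assume v: "v \<in> ?R"
      have "discriminant p m (\<lambda>k. g (v k)) = 0" if "g \<in> ?G" for g
        using S[OF that] v by force
      then show "v \<in> ?L"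
        using v by blast
    qed
  qed
  moreover have "S \<subseteq> poly_funs (power_coords m)"
    by (auto simp: S_def)
  ultimately show ?thesis
    unfolding generic_orbit[OF assms] zariski_open_in_power_def zariski_closed_in_power_def by blast
qed

theorem proposition25:
  fixes p :: "complex poly" and \<nu> :: nat
  assumes "degree p = \<nu>" and "\<nu> \<ge> 2"
    and "\<forall>a. poly p a = 0 \<longrightarrow> Polynomial.order a p = 1"
  shows "(\<forall>D \<in> {D1 p, D2 p, D3 p, D4 p}. locally_nilpotent_derivation (danielewski p) D) \<and>
         generically_infinitely_transitive
           (flow_group (danielewski p) {D1 p, D2 p, D3 p, D4 p}) (danielewski p) (\<lambda>\<phi>. \<phi>)"
  unfolding generically_infinitely_transitive_def
proof (intro conjI danielewski_locally_nilpotent group_action_flow_group allI impI)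
  fix m :: nat
  have deg: "degree p \<ge> 2"
    using assms by simp
  obtain w where "w \<in> cart_power (danielewski p) m" "discriminant p m w \<noteq> 0"
    by (rule generic_exists[OF deg]) (rule that)
  then show "\<exists>w \<in> cart_power (danielewski p) m. zariski_open_in_power (danielewski p) m
      (orbit (danielewski_group p) (diagonal_action (danielewski p) m (\<lambda>\<phi>. \<phi>)) w)"
    using generic_orbit_zariski_open[OF deg] by blast
qed

end
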